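(* Let $T$ be a linearly ordered infinite set, let $\varOmega$ be a $c$-filter in $\mathbb{C}^T$, and let $\mathcal{K}=\mathcal{N}^{\mathbb{C}}_{\varOmega}$ be the field of Nash functions. Let $g=(g_t\in\mathcal{K}:t\in T)$ be the family constructed in the context (for any choices made in that construction), and let $\delta_g(f)=\sum_{t\in T}g_t\frac{\partial f}{\partial\Lambda_t}$ for $f\in\mathcal{K}$. Then $(\mathcal{K},\delta_g)$ is a differentially closed field.
   Context: **Differentially closed fields.** A differential field $(K,\delta)$ is a field of characteristic zero with one derivation $\delta$. $K\{y\}=K[y_{\delta^0},y_{\delta},y_{\delta^2},\ldots]$ is the ring of differential polynomials; $p(a)$ is obtained by substituting $\delta^j(a)$ for $y_{\delta^j}$; $\operatorname{ord}p$ is the largest $n$ such that $y_{\delta^n}$ occurs in $p$, and $-1$ if $p\in K$. $(K,\delta)$ is differentially closed if for each pair $p,q\in K\{y\}$ with $\operatorname{ord}q<\operatorname{ord}p$ and $q\neq0$ there is $a\in K$ with $p(a)=0$ and $q(a)\neq0$. **Nash functions.** $\Lambda_T=(\Lambda_t:t\in T)$ is a system of independent variables; $\mathbb{C}^T$ is the set of functions $T\to\mathbb{C}$ with the product topology. A subset of $\mathbb{C}^T$ is $\mathbb{Q}$-algebraic if it is defined by a finite system of equations $P=0$, $P\in\mathbb{Q}[\Lambda_T]$. It is $\mathbb{Q}$-semialgebraic if, identifying $\mathbb{C}^T$ with $(\mathbb{R}^T)^2$, it is defined by a finite boolean combination of inequalities $P>0$ or $P\ge0$, where $P$ is a polynomial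 with rational coefficients in the real and imaginary parts of (finitely many) coordinates. A $c$-filter in $\mathbb{C}^T$ is a family $\varOmega$ of subsets of $\mathbb{C}^T$ such that: (i) any $U\in\varOmega$ is a nonempty open connected $\mathbb{Q}$-semialgebraic set; (ii) for any $\mathbb{Q}$-algebraic set $V\subsetneq\mathbb{C}^T$ there is $U\in\varOmega$ with $V\cap U=\emptyset$; (iii) for any $U_1,U_2\in\varOmega$ there is $U_3\in\varOmega$ with $U_3\subset U_1\cap U_2$; (iv) for any $U\in\varOmega$ there exist an open connected and simply connected $\mathbb{Q}$-semialgebraic set $U_0\subset\mathbb{C}^T$ and $U'\in\varOmega$ with $U'\subset U_0\subset U$. $\mathcal{N}^{\mathbb{C}}(U)$ is the ring of holomorphic functions $f:U\to\mathbb{C}$ for which there is a nonzero $P\in\mathbb{Q}[\Lambda_T,Z]$ with $P(\lambda,f(\lambda))=0$ on $U$ (such functions depend on finitely many variables). $\mathcal{N}^{\mathbb{C}}_{\varOmega}$ is the set of classes of elements of $\bigcup_{U\in\varOmega}\mathcal{N}^{\mathbb{C}}(U)$ under $(f_1:U_1\to\mathbb{C})\sim(f_2:U_2\to\mathbb{C})$ iff $f_1|_{U_3}=f_2|_{U_3}$ for some $U_3\in\varOmega$; with pointwise operations it is a field, and it is the algebraic closure of $\mathbb{Q}(\Lambda_T)$ (known). **Construction of $g$.** Let $\prec$ be the strict order of $T$. Let $\mathcal{K}[Y]=\mathcal{K}[Y_j:j\in\mathbb{N}]$ ($0\in\mathbb{N}$). For $\mathcal{P}\in\mathcal{K}[Y]$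 let $D(\mathcal{P})=\{t\in T:\frac{\partial\mathcal{P}}{\partial\Lambda_t}=0\}$ (the derivative acts on the coefficients); $T\setminus D(\mathcal{P})$ is finite. Let $\alpha(\mathcal{P})=\max\{j:\deg_{Y_j}\mathcal{P}>0\}$ if $\deg\mathcal{P}>0$, $\alpha(\mathcal{P})=-1$ if $\mathcal{P}\in\mathcal{K}\setminus\{0\}$, $\alpha(0)=-\infty$. Let $\mathcal{A}=\{(\mathcal{P},\mathcal{Q})\in\mathcal{K}[Y]^2:\alpha(\mathcal{P})>\alpha(\mathcal{Q})\ge-1\}$. The sets $T$ and $\mathcal{A}$ have the same cardinality, so one can fix a family of pairwise disjoint infinite countable subsets $T_{\mathcal{P},\mathcal{Q}}\subset T$, $(\mathcal{P},\mathcal{Q})\in\mathcal{A}$, with union $T$. For each $(\mathcal{P},\mathcal{Q})\in\mathcal{A}$ with $\alpha(\mathcal{P})>0$ fix points $t_{\mathcal{P},\mathcal{Q},0}\prec\cdots\prec t_{\mathcal{P},\mathcal{Q},\alpha(\mathcal{P})-1}$ in $D(\mathcal{P})\cap D(\mathcal{Q})\cap T_{\mathcal{P},\mathcal{Q}}$ (no points if $\alpha(\mathcal{P})=0$). Then $\mathcal{P}(\Lambda_{t_{\mathcal{P},\mathcal{Q},0}},\ldots,\Lambda_{t_{\mathcal{P},\mathcal{Q},\alpha(\mathcal{P})-1}},Y_{\alpha(\mathcal{P})})$ has positive degree in $Y_{\alpha(\mathcal{P})}$; let $g_{\mathcal{P},\mathcal{Q}}\in\mathcal{K}$ be a root of it.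 Define, for each $(\mathcal{P},\mathcal{Q})\in\mathcal{A}$ and $t\in T_{\mathcal{P},\mathcal{Q}}$: $g_t=\Lambda_{t_{\mathcal{P},\mathcal{Q},i+1}}$ if $t=t_{\mathcal{P},\mathcal{Q},i}$, $0\le i\le\alpha(\mathcal{P})-2$; $g_t=g_{\mathcal{P},\mathcal{Q}}$ if $t=t_{\mathcal{P},\mathcal{Q},\alpha(\mathcal{P})-1}$; and $g_t=f_t$, with $f_t\in\mathcal{K}$ arbitrary, for all other $t\in T_{\mathcal{P},\mathcal{Q}}$ (with the natural conventions when $\alpha(\mathcal{P})\in\{0,1\}$: cases referring to nonexistent points are void). For each $f$ the sum defining $\delta_g(f)$ has finitely many nonzero terms, and $\delta_g$ is a derivation on $\mathcal{K}$. *)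

theory Defs
  imports
    "HOL-Analysis.Analysis"
    "HOL-Library.Poly_Mapping"
    "HOL-Algebra.Indexed_Polynomials"
begin

section \<open>Differentially closed fields\<close>

text \<open>
  A polynomial in variables indexed by the naturals is an element of
  \<^term>\<open>ring.indexed_pset R UNIV (carrier R)\<close>, that is, a finitely supported function from
  monomials (multisets of variables) to coefficients. The same ring serves as the polynomial
  ring in the variables \<open>Y\<^sub>j\<close> and, reading the variable \<open>j\<close> as the \<open>j\<close>-th derivative
  of \<open>y\<close>, as the ring of differential polynomials.
\<close>

abbreviation npolys :: "('a, 'b) ring_scheme \<Rightarrow> (nat multiset \<Rightarrow> 'a) set" where
  "npolys R \<equiv> ring.indexed_pset R UNIV (carrier R)"

abbreviation npoly_zero :: "('a, 'b) ring_scheme \<Rightarrow> nat multiset \<Rightarrow> 'a" where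
  "npoly_zero R \<equiv> ring.indexed_const R \<zero>\<^bsub>R\<^esub>"

definition npoly_eval ::
  "('a, 'b) ring_scheme \<Rightarrow> (nat multiset \<Rightarrow> 'a) \<Rightarrow> (nat \<Rightarrow> 'a) \<Rightarrow> 'a" where
  "npoly_eval R p x =
     (\<Oplus>\<^bsub>R\<^esub>m \<in> {m. p m \<noteq> \<zero>\<^bsub>R\<^esub>}.
        p m \<otimes>\<^bsub>R\<^esub> (\<Otimes>\<^bsub>R\<^esub>j \<in> set_mset m. x j [^]\<^bsub>R\<^esub> count m j))"

text \<open>\<^term>\<open>\<not> ring.index_free R p j\<close> says that the variable \<open>j\<close> occurs in \<open>p\<close>.\<close>

definition npoly_ord :: "('a, 'b) ring_scheme \<Rightarrow> (nat multiset \<Rightarrow> 'a) \<Rightarrow> int" where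
  "npoly_ord R p =
     (if \<forall>j. ring.index_free R p j then - 1
      else int (Max {j. \<not> ring.index_free R p j}))"

definition derivation :: "('a, 'b) ring_scheme \<Rightarrow> ('a \<Rightarrow> 'a) \<Rightarrow> bool" where
  "derivation R \<delta> \<longleftrightarrow>
     \<delta> \<in> carrier R \<rightarrow> carrier R \<and>
     (\<forall>a \<in> carrier R. \<forall>b \<in> carrier R.
        \<delta> (a \<oplus>\<^bsub>R\<^esub> b) = \<delta> a \<oplus>\<^bsub>R\<^esub> \<delta> b \<and>
        \<delta> (a \<otimes>\<^bsub>R\<^esub> b) = (\<delta> a \<otimes>\<^bsub>R\<^esub> b) \<oplus>\<^bsub>R\<^esub> (a \<otimes>\<^bsub>R\<^esub> \<delta> b))"

definition differential_field :: "('a, 'b) ring_scheme \<Rightarrow> ('a \<Rightarrow> 'a) \<Rightarrow> bool" where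
  "differential_field R \<delta> \<longleftrightarrow>
     field R \<and> (\<forall>n::nat. n > 0 \<longrightarrow> [n] \<cdot>\<^bsub>R\<^esub> \<one>\<^bsub>R\<^esub> \<noteq> \<zero>\<^bsub>R\<^esub>) \<and> derivation R \<delta>"

definition diffpoly_eval ::
  "('a, 'b) ring_scheme \<Rightarrow> ('a \<Rightarrow> 'a) \<Rightarrow> (nat multiset \<Rightarrow> 'a) \<Rightarrow> 'a \<Rightarrow> 'a" where
  "diffpoly_eval R \<delta> p a = npoly_eval R p (\<lambda>j. (\<delta> ^^ j) a)"

definition differentially_closed_field :: "('a, 'b) ring_scheme \<Rightarrow> ('a \<Rightarrow> 'a) \<Rightarrow> bool" where
  "differentially_closed_field R \<delta> \<longleftrightarrow>
     differential_field R \<delta> \<and>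
     (\<forall>p \<in> npolys R. \<forall>q \<in> npolys R.
        npoly_ord R q < npoly_ord R p \<and> q \<noteq> npoly_zero R \<longrightarrow>
        (\<exists>a \<in> carrier R. diffpoly_eval R \<delta> p a = \<zero>\<^bsub>R\<^esub> \<and> diffpoly_eval R \<delta> q a \<noteq> \<zero>\<^bsub>R\<^esub>))"


section \<open>Algebraic and semialgebraic sets over the rationals\<close>

type_synonym 'v qpoly = "('v \<Rightarrow>\<^sub>0 nat) \<Rightarrow>\<^sub>0 rat"

definition qpoly_eval :: "'v qpoly \<Rightarrow> ('v \<Rightarrow> 'a::field_char_0) \<Rightarrow> 'a" where
  "qpoly_eval P x =
     (\<Sum>m \<in> Poly_Mapping.keys P. of_rat (Poly_Mapping.lookup P m) *
        (\<Prod>v \<in> Poly_Mapping.keys m. x v ^ Poly_Mapping.lookup m v))"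

text \<open>
  The index set is the type \<open>'t\<close>; the space \<^typ>\<open>'t \<Rightarrow> complex\<close> carries the product topology.
\<close>

definition Q_algebraic :: "('t \<Rightarrow> complex) set \<Rightarrow> bool" where
  "Q_algebraic V \<longleftrightarrow>
     (\<exists>F :: 't qpoly set. finite F \<and> V = {x. \<forall>P \<in> F. qpoly_eval P x = 0})"

definition real_coords :: "('t \<Rightarrow> complex) \<Rightarrow> 't + 't \<Rightarrow> real" where
  "real_coords x = case_sum (\<lambda>t. Re (x t)) (\<lambda>t. Im (x t))"

inductive Q_semialgebraic :: "('t \<Rightarrow> complex) set \<Rightarrow> bool" where
  positive: "Q_semialgebraic {x. qpoly_eval P (real_coords x) > 0}"
| nonnegative: "Q_semialgebraic {x. qpoly_eval P (real_coords x) \<ge> 0}"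
| complement: "Q_semialgebraic A \<Longrightarrow> Q_semialgebraic (- A)"
| intersection: "Q_semialgebraic A \<Longrightarrow> Q_semialgebraic B \<Longrightarrow> Q_semialgebraic (A \<inter> B)"
| union: "Q_semialgebraic A \<Longrightarrow> Q_semialgebraic B \<Longrightarrow> Q_semialgebraic (A \<union> B)"

definition c_filter :: "('t \<Rightarrow> complex) set set \<Rightarrow> bool" where
  "c_filter \<Omega> \<longleftrightarrow>
     (\<forall>U \<in> \<Omega>. U \<noteq> {} \<and> open U \<and> connected U \<and> Q_semialgebraic U) \<and>
     (\<forall>V. Q_algebraic V \<and> V \<noteq> UNIV \<longrightarrow> (\<exists>U \<in> \<Omega>. V \<inter> U = {})) \<and>
     (\<forall>U\<^sub>1 \<in> \<Omega>. \<forall>U\<^sub>2 \<in> \<Omega>. \<exists>U\<^sub>3 \<in> \<Omega>. U\<^sub>3 \<subseteq> U\<^sub>1 \<inter> U\<^sub>2) \<and>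
     (\<forall>U \<in> \<Omega>. \<exists>U\<^sub>0. open U\<^sub>0 \<and> connected U\<^sub>0 \<and> simply_connected U\<^sub>0 \<and> Q_semialgebraic U\<^sub>0 \<and>
        (\<exists>U' \<in> \<Omega>. U' \<subseteq> U\<^sub>0 \<and> U\<^sub>0 \<subseteq> U))"


section \<open>The field of Nash functions\<close>

text \<open>
  Holomorphy on an open subset of the locally convex space \<^typ>\<open>'t \<Rightarrow> complex\<close>: continuity
  together with holomorphy along every complex line.
\<close>

definition holomorphic_fun :: "(('t \<Rightarrow> complex) \<Rightarrow> complex) \<Rightarrow> ('t \<Rightarrow> complex) set \<Rightarrow> bool" where
  "holomorphic_fun f U \<longleftrightarrow>
     continuous_on U f \<and>
     (\<forall>a v. (\<lambda>z. f (\<lambda>t. a t + z * v t)) holomorphic_on {z. (\<lambda>t. a t + z * v t) \<in> U})"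

text \<open>
  In the annihilating polynomial the variable \<^term>\<open>Some t\<close> stands for \<open>\<Lambda>\<^sub>t\<close> and \<^term>\<open>None\<close>
  for \<open>Z\<close>. Functions are total; their values outside \<open>U\<close> are irrelevant, since they are
  ignored by the relation \<open>nash_rel\<close> below.
\<close>

definition nash_functions :: "('t \<Rightarrow> complex) set \<Rightarrow> (('t \<Rightarrow> complex) \<Rightarrow> complex) set" where
  "nash_functions U =
     {f. holomorphic_fun f U \<and>
         (\<exists>P :: 't option qpoly. P \<noteq> 0 \<and> (\<forall>x \<in> U. qpoly_eval P (case_option (f x) x) = 0))}"

type_synonym 't nash_pair = "('t \<Rightarrow> complex) set \<times> (('t \<Rightarrow> complex) \<Rightarrow> complex)"
type_synonym 't nash_germ = "'t nash_pair set"

definition nash_pairs :: "('t \<Rightarrow> complex) set set \<Rightarrow> 't nash_pair set" where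
  "nash_pairs \<Omega> = Sigma \<Omega> nash_functions"

definition nash_rel :: "('t \<Rightarrow> complex) set set \<Rightarrow> ('t nash_pair \<times> 't nash_pair) set" where
  "nash_rel \<Omega> =
     {((U\<^sub>1, f\<^sub>1), (U\<^sub>2, f\<^sub>2)). (U\<^sub>1, f\<^sub>1) \<in> nash_pairs \<Omega> \<and> (U\<^sub>2, f\<^sub>2) \<in> nash_pairs \<Omega> \<and>
        (\<exists>U\<^sub>3 \<in> \<Omega>. U\<^sub>3 \<subseteq> U\<^sub>1 \<inter> U\<^sub>2 \<and> (\<forall>x \<in> U\<^sub>3. f\<^sub>1 x = f\<^sub>2 x))}"

text \<open>
  The operations on classes are the pointwise ones, described without choosing representatives:
  the result consists of all pairs that agree on some member of \<open>\<Omega>\<close> with the pointwise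
  result computed from representatives of the arguments.
\<close>

definition nash_of_fun ::
  "('t \<Rightarrow> complex) set set \<Rightarrow> (('t \<Rightarrow> complex) \<Rightarrow> complex) \<Rightarrow> 't nash_germ" where
  "nash_of_fun \<Omega> f =
     {(V, h) \<in> nash_pairs \<Omega>. \<exists>W \<in> \<Omega>. W \<subseteq> V \<and> (\<forall>x \<in> W. h x = f x)}"

definition nash_lift2 ::
  "('t \<Rightarrow> complex) set set \<Rightarrow> (complex \<Rightarrow> complex \<Rightarrow> complex) \<Rightarrow>
   't nash_germ \<Rightarrow> 't nash_germ \<Rightarrow> 't nash_germ" where
  "nash_lift2 \<Omega> oper A B =
     {(V, h) \<in> nash_pairs \<Omega>. \<exists>(U\<^sub>1, f\<^sub>1) \<in> A. \<exists>(U\<^sub>2, f\<^sub>2) \<in> B. \<exists>W \<in> \<Omega>.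
        W \<subseteq> V \<inter> U\<^sub>1 \<inter> U\<^sub>2 \<and> (\<forall>x \<in> W. h x = oper (f\<^sub>1 x) (f\<^sub>2 x))}"

definition nash_field :: "('t \<Rightarrow> complex) set set \<Rightarrow> 't nash_germ ring" where
  "nash_field \<Omega> =
     \<lparr>carrier = nash_pairs \<Omega> // nash_rel \<Omega>,
      monoid.mult = nash_lift2 \<Omega> (\<lambda>a b. a * b),
      one = nash_of_fun \<Omega> (\<lambda>_. 1),
      ring.zero = nash_of_fun \<Omega> (\<lambda>_. 0),
      add = nash_lift2 \<Omega> (\<lambda>a b. a + b)\<rparr>"

definition nash_var :: "('t \<Rightarrow> complex) set set \<Rightarrow> 't \<Rightarrow> 't nash_germ" where
  "nash_var \<Omega> t = nash_of_fun \<Omega> (\<lambda>x. x t)"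

definition nash_partial :: "('t \<Rightarrow> complex) set set \<Rightarrow> 't \<Rightarrow> 't nash_germ \<Rightarrow> 't nash_germ" where
  "nash_partial \<Omega> t A =
     {(V, h) \<in> nash_pairs \<Omega>. \<exists>(U, f) \<in> A. \<exists>W \<in> \<Omega>.
        W \<subseteq> V \<inter> U \<and> (\<forall>x \<in> W. h x = deriv (\<lambda>z. f (x(t := z))) (x t))}"

text \<open>
  The sum over all \<open>t\<close> is taken over the indices with nonzero term, because \<open>finsum\<close> over an
  infinite index set is zero by convention.
\<close>

definition nash_delta ::
  "('t \<Rightarrow> complex) set set \<Rightarrow> ('t \<Rightarrow> 't nash_germ) \<Rightarrow> 't nash_germ \<Rightarrow> 't nash_germ" where
  "nash_delta \<Omega> g f =
     (let K = nash_field \<Omega> in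
        (\<Oplus>\<^bsub>K\<^esub>t \<in> {t. g t \<otimes>\<^bsub>K\<^esub> nash_partial \<Omega> t f \<noteq> \<zero>\<^bsub>K\<^esub>}. g t \<otimes>\<^bsub>K\<^esub> nash_partial \<Omega> t f))"


section \<open>The construction of the coefficients of the derivation\<close>

definition D_set ::
  "('t \<Rightarrow> complex) set set \<Rightarrow> (nat multiset \<Rightarrow> 't nash_germ) \<Rightarrow> 't set" where
  "D_set \<Omega> P = {t. (\<lambda>m. nash_partial \<Omega> t (P m)) = npoly_zero (nash_field \<Omega>)}"

definition npoly_alpha :: "('a, 'b) ring_scheme \<Rightarrow> (nat multiset \<Rightarrow> 'a) \<Rightarrow> ereal" where
  "npoly_alpha R P =
     (if P = npoly_zero R then - \<infinity> else ereal (real_of_int (npoly_ord R P)))"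

type_synonym 't nash_poly_pair =
  "(nat multiset \<Rightarrow> 't nash_germ) \<times> (nat multiset \<Rightarrow> 't nash_germ)"

definition A_pairs :: "('t \<Rightarrow> complex) set set \<Rightarrow> 't nash_poly_pair set" where
  "A_pairs \<Omega> =
     {(P, Q). P \<in> npolys (nash_field \<Omega>) \<and> Q \<in> npolys (nash_field \<Omega>) \<and>
        npoly_alpha (nash_field \<Omega>) P > npoly_alpha (nash_field \<Omega>) Q \<and>
        npoly_alpha (nash_field \<Omega>) Q \<ge> - 1}"

text \<open>
  Here \<open>Tf\<close> is the partition of the index set, \<open>\<tau> (P, Q) i\<close> are the chosen points,
  \<open>r (P, Q)\<close> is the chosen root, and \<open>f\<close> is the arbitrary family. For a pair in
  \<^term>\<open>A_pairs \<Omega>\<close> the number \<open>n\<close> is the (nonnegative) value \<open>\<alpha>\<close> of \<open>P\<close>; since no variable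
  of index above \<open>n\<close> occurs in \<open>P\<close>, the equation for \<open>r (P, Q)\<close> says that it is a root of the
  polynomial in \<open>Y\<^sub>n\<close> obtained from \<open>P\<close> by substituting \<open>\<Lambda>\<close> at the chosen points for the
  variables of index below \<open>n\<close>.
\<close>

definition nash_construction ::
  "('t::linorder \<Rightarrow> complex) set set \<Rightarrow> ('t nash_poly_pair \<Rightarrow> 't set) \<Rightarrow>
   ('t nash_poly_pair \<Rightarrow> nat \<Rightarrow> 't) \<Rightarrow> ('t nash_poly_pair \<Rightarrow> 't nash_germ) \<Rightarrow>
   ('t \<Rightarrow> 't nash_germ) \<Rightarrow> ('t \<Rightarrow> 't nash_germ) \<Rightarrow> bool" where
  "nash_construction \<Omega> Tf \<tau> r f g \<longleftrightarrow>
     (\<forall>S \<in> A_pairs \<Omega>. infinite (Tf S) \<and> countable (Tf S)) \<and>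
     disjoint_family_on Tf (A_pairs \<Omega>) \<and>
     (\<Union>S \<in> A_pairs \<Omega>. Tf S) = UNIV \<and>
     (\<forall>t. f t \<in> carrier (nash_field \<Omega>)) \<and>
     (\<forall>(P, Q) \<in> A_pairs \<Omega>.
        let K = nash_field \<Omega>; n = nat (npoly_ord K P); s = \<tau> (P, Q) in
          (\<forall>i < n. s i \<in> D_set \<Omega> P \<inter> D_set \<Omega> Q \<inter> Tf (P, Q)) \<and>
          (\<forall>i j. i < j \<and> j < n \<longrightarrow> s i < s j) \<and>
          r (P, Q) \<in> carrier K \<and>
          npoly_eval K P (\<lambda>j. if j < n then nash_var \<Omega> (s j) else r (P, Q)) = \<zero>\<^bsub>K\<^esub> \<and>
          (\<forall>i. i + 1 < n \<longrightarrow> g (s i) = nash_var \<Omega> (s (i + 1))) \<and>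
          (n > 0 \<longrightarrow> g (s (n - 1)) = r (P, Q)) \<and>
          (\<forall>t \<in> Tf (P, Q) - s ` {..<n}. g t = f t))"

end

(*
  A Nash germ f is annihilated by a polynomial over the rational polynomial functions. Closure of
  such germs under the field operations follows from the Cayley-Hamilton argument and from the
  identity theorem on connected open sets. Implicit differentiation of an annihilator of least
  degree expresses every partial derivative of f rationally in f, so the derivation is well defined.

  For a pair (p, q) with ord q < ord p = n, put a = Lambda_{s 0} if n > 0 and let a be the chosen
  root if n = 0. By construction the first n derivatives of a are the variables Lambda_{s 0}, ...,
  Lambda_{s (n-1)} followed by the root, so p(a) = 0. The coefficients of q do not depend on these
  variables; hence q(a) = q(Lambda_{s 0}, ..., Lambda_{s (n-1)}) cannot vanish, as one sees by
  differentiating a hypothetical relation with respect to the variables until one coefficient is left.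
*)
theory Submission
  imports Defs "Jordan_Normal_Form.Char_Poly" "HOL-Complex_Analysis.Complex_Analysis"
begin


section \<open>Rational polynomials as functions\<close>

text \<open>The zeros of a Nash function are not presented by rational polynomial equations, so
  condition (ii) of a c-filter says nothing about them directly; yet the inverse of a nonzero germ
  must be holomorphic on a whole member of \<Omega>. The bridge is a zero-one law: a Nash function
  vanishes on some member of \<Omega> or has no zero on some member. It moves the question from the
  function to the constant term of an annihilator, a rational polynomial to which (ii) applies.
  Formal polynomials are replaced by the functions they define, and being nonzero becomes being
  nonzero somewhere, which (ii) strengthens to being nonzero throughout a member of \<Omega>. The
  field of rational functions is avoided: denominators are cleared, annihilators need not be monic,
  and algebraic identities are asserted eventually along the filter generated by \<Omega>. Germs
  thereby become total functions modulo eventual equality.\<close>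

definition mon :: "('v \<Rightarrow>\<^sub>0 nat) \<Rightarrow> ('v \<Rightarrow> 'a::field_char_0) \<Rightarrow> 'a" where
  "mon m x = (\<Prod>v\<in>Poly_Mapping.keys m. x v ^ Poly_Mapping.lookup m v)"

lemma qpoly_eval_mon:
  "qpoly_eval P x = (\<Sum>m\<in>Poly_Mapping.keys P. of_rat (Poly_Mapping.lookup P m) * mon m x)"
  by (simp add: qpoly_eval_def mon_def)

lemma mon_superset:
  assumes "finite S" "Poly_Mapping.keys m \<subseteq> S"
  shows "mon m x = (\<Prod>v\<in>S. x v ^ Poly_Mapping.lookup m v)"
  unfolding mon_def by (rule prod.mono_neutral_left) (use assms in \<open>auto simp: in_keys_iff\<close>)

lemma mon_add: "mon (m + n) x = mon m x * mon n x"
proof -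
  let ?S = "Poly_Mapping.keys m \<union> Poly_Mapping.keys n"
  have "mon (m + n) x = (\<Prod>v\<in>?S. x v ^ Poly_Mapping.lookup (m + n) v)"
    by (rule mon_superset) (auto simp: Poly_Mapping.keys_add)
  also have "\<dots> = mon m x * mon n x"
    by (simp add: mon_superset[of ?S m] mon_superset[of ?S n] lookup_add power_add prod.distrib)
  finally show ?thesis .
qed

lemma qpoly_eval_superset:
  assumes "finite S" "Poly_Mapping.keys P \<subseteq> S"
  shows "qpoly_eval P x = (\<Sum>m\<in>S. of_rat (Poly_Mapping.lookup P m) * mon m x)"
  unfolding qpoly_eval_mon
  by (rule sum.mono_neutral_left) (use assms in \<open>auto simp: in_keys_iff\<close>)

lemma qpoly_eval_add: "qpoly_eval (P + Q) x = qpoly_eval P x + qpoly_eval Q x"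
proof -
  let ?S = "Poly_Mapping.keys P \<union> Poly_Mapping.keys Q"
  have "qpoly_eval (P + Q) x = (\<Sum>m\<in>?S. of_rat (Poly_Mapping.lookup (P + Q) m) * mon m x)"
    by (rule qpoly_eval_superset) (auto simp: Poly_Mapping.keys_add)
  also have "\<dots> = qpoly_eval P x + qpoly_eval Q x"
    by (simp add: qpoly_eval_superset[of ?S P] qpoly_eval_superset[of ?S Q] lookup_add
        of_rat_add algebra_simps sum.distrib)
  finally show ?thesis .
qed

lemma qpoly_eval_zero [simp]: "qpoly_eval 0 x = 0"
  by (simp add: qpoly_eval_def)

lemma qpoly_eval_sum: "qpoly_eval (sum F S) x = (\<Sum>i\<in>S. qpoly_eval (F i) x)"
  by (induction S rule: infinite_finite_induct) (auto simp: qpoly_eval_add)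

lemma qpoly_eval_single: "qpoly_eval (Poly_Mapping.single m c) x = of_rat c * mon m x"
  by (cases "c = 0") (auto simp: qpoly_eval_mon)

lemma poly_mapping_sum_singles:
  "P = (\<Sum>m\<in>Poly_Mapping.keys P. Poly_Mapping.single m (Poly_Mapping.lookup P m))"
  by (rule poly_mapping_eqI) (auto simp: lookup_sum lookup_single when_def sum.delta in_keys_iff)

lemma qpoly_eval_mult: "qpoly_eval (P * Q) x = qpoly_eval P x * qpoly_eval Q x"
proof -
  let ?p = "\<lambda>m. Poly_Mapping.single m (Poly_Mapping.lookup P m)"
  let ?q = "\<lambda>m. Poly_Mapping.single m (Poly_Mapping.lookup Q m)"
  have "P * Q = (\<Sum>m\<in>Poly_Mapping.keys P. \<Sum>n\<in>Poly_Mapping.keys Q. ?p m * ?q n)"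
    by (subst (1) poly_mapping_sum_singles[of P], subst (1) poly_mapping_sum_singles[of Q])
      (simp add: sum_product)
  then have "qpoly_eval (P * Q) x =
      (\<Sum>m\<in>Poly_Mapping.keys P. \<Sum>n\<in>Poly_Mapping.keys Q. qpoly_eval (?p m * ?q n) x)"
    by (simp add: qpoly_eval_sum)
  also have "\<dots> = qpoly_eval P x * qpoly_eval Q x"
    by (simp add: mult_single qpoly_eval_single qpoly_eval_mon[of P] qpoly_eval_mon[of Q]
        sum_product mon_add of_rat_mult mult_ac)
  finally show ?thesis .
qed

text \<open>Formal polynomials are traded for functions on complex points, where substitution and
  differentiation are pointwise; nothing is lost, since only the zero polynomial vanishes everywhere
  (\<open>qpoly_eval_eq_zero\<close>).\<close>

definition polyfuns :: "(('v \<Rightarrow> complex) \<Rightarrow> complex) set" where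
  "polyfuns = range qpoly_eval"

lemma polyfuns_const [simp]: "(\<lambda>x. of_rat c) \<in> polyfuns"
proof -
  have "(\<lambda>x. of_rat c) = qpoly_eval (Poly_Mapping.single 0 c)"
    by (auto simp: fun_eq_iff qpoly_eval_single mon_def)
  then show ?thesis by (auto simp: polyfuns_def)
qed

lemma polyfuns_consts [simp]:
  "(\<lambda>x. 0) \<in> polyfuns" "(\<lambda>x. 1) \<in> polyfuns" "(\<lambda>x. of_nat n) \<in> polyfuns" "(\<lambda>x. - 1) \<in> polyfuns"
  "(\<lambda>x. of_int k) \<in> polyfuns"
  using polyfuns_const[of 0] polyfuns_const[of 1] polyfuns_const[of "of_nat n"]
    polyfuns_const[of "- 1"] polyfuns_const[of "of_int k"] by (simp_all add: of_rat_minus)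

lemma polyfuns_var [simp]: "(\<lambda>x. x v) \<in> polyfuns"
proof -
  have "(\<lambda>x. x v) = qpoly_eval (Poly_Mapping.single (Poly_Mapping.single v 1) 1)"
    by (auto simp: fun_eq_iff qpoly_eval_single mon_def)
  then show ?thesis by (auto simp: polyfuns_def)
qed

lemma polyfuns_add [intro]:
  assumes "p \<in> polyfuns" "q \<in> polyfuns" shows "(\<lambda>x. p x + q x) \<in> polyfuns"
proof -
  from assms obtain P Q where "p = qpoly_eval P" "q = qpoly_eval Q" by (auto simp: polyfuns_def)
  then have "(\<lambda>x. p x + q x) = qpoly_eval (P + Q)" by (auto simp: qpoly_eval_add)
  then show ?thesis by (auto simp: polyfuns_def)
qed

lemma polyfuns_mult [intro]:
  assumes "p \<in> polyfuns" "q \<in> polyfuns" shows "(\<lambda>x. p x * q x) \<in> polyfuns"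
proof -
  from assms obtain P Q where "p = qpoly_eval P" "q = qpoly_eval Q" by (auto simp: polyfuns_def)
  then have "(\<lambda>x. p x * q x) = qpoly_eval (P * Q)" by (auto simp: qpoly_eval_mult)
  then show ?thesis by (auto simp: polyfuns_def)
qed

lemma polyfuns_uminus [intro]: "p \<in> polyfuns \<Longrightarrow> (\<lambda>x. - p x) \<in> polyfuns"
  using polyfuns_mult[of "\<lambda>x. - 1" p] by simp

lemma polyfuns_sum [intro]:
  "(\<And>i. i \<in> S \<Longrightarrow> p i \<in> polyfuns) \<Longrightarrow> (\<lambda>x. \<Sum>i\<in>S. p i x) \<in> polyfuns"
  by (induction S rule: infinite_finite_induct) auto

lemma polyfuns_power [intro]: "p \<in> polyfuns \<Longrightarrow> (\<lambda>x. p x ^ n) \<in> polyfuns"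
  by (induction n) auto

lemma polyfuns_induct [consumes 1, case_names const var add mult]:
  assumes "p \<in> polyfuns"
    and const: "\<And>c. R (\<lambda>x. of_rat c)"
    and var: "\<And>v. R (\<lambda>x. x v)"
    and add: "\<And>p q. p \<in> polyfuns \<Longrightarrow> q \<in> polyfuns \<Longrightarrow> R p \<Longrightarrow> R q \<Longrightarrow> R (\<lambda>x. p x + q x)"
    and mult: "\<And>p q. p \<in> polyfuns \<Longrightarrow> q \<in> polyfuns \<Longrightarrow> R p \<Longrightarrow> R q \<Longrightarrow> R (\<lambda>x. p x * q x)"
  shows "R p"
proof -
  \<comment> \<open>\<open>R'\<close> carries membership along with \<open>R\<close>: the hypotheses
    on sums and products demand it of the operands, which here are partial sums and
    products.\<close>
  define R' where "R' = (\<lambda>p. p \<in> polyfuns \<and> R p)"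
  have const': "R' (\<lambda>x. of_rat c)" for c using const by (simp add: R'_def)
  have var': "R' (\<lambda>x. x v)" for v using var by (simp add: R'_def)
  have add': "R' (\<lambda>x. p x + q x)" and mult': "R' (\<lambda>x. p x * q x)" if "R' p" "R' q" for p q
    using that add mult by (auto simp: R'_def)
  have c0: "R' (\<lambda>x. 0)" and c1: "R' (\<lambda>x. 1)" using const'[of 0] const'[of 1] by simp_all
  have pow: "R' (\<lambda>x. x v ^ k)" for v and k :: nat
    by (induction k) (use c1 mult'[OF var'] in auto)
  have prd: "R' (\<lambda>x. \<Prod>v\<in>S. x v ^ k v)" for S and k :: "_ \<Rightarrow> nat"
    by (induction S rule: infinite_finite_induct) (auto intro: c1 mult' pow)
  have sm: "R' (\<lambda>x. \<Sum>m\<in>S. of_rat (c m) * mon m x)" for S and c :: "_ \<Rightarrow> rat"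
    by (induction S rule: infinite_finite_induct) (auto intro!: c0 add' mult' const' prd simp: mon_def)
  from assms(1) obtain P where "p = qpoly_eval P" by (auto simp: polyfuns_def)
  then have "p = (\<lambda>x. \<Sum>m\<in>Poly_Mapping.keys P. of_rat (Poly_Mapping.lookup P m) * mon m x)"
    by (simp add: fun_eq_iff qpoly_eval_mon)
  with sm have "R' p" by simp
  then show ?thesis by (simp add: R'_def)
qed

lemma polyfuns_rename:
  "p \<in> polyfuns \<Longrightarrow> (\<lambda>y. p (\<lambda>v. y (s v))) \<in> polyfuns"
  by (induction rule: polyfuns_induct) auto

section \<open>Partial derivatives in a single coordinate\<close>

definition dpart :: "'v \<Rightarrow> (('v \<Rightarrow> complex) \<Rightarrow> complex) \<Rightarrow> ('v \<Rightarrow> complex) \<Rightarrow> complex" where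
  "dpart t f x = deriv (\<lambda>z. f (x(t := z))) (x t)"

text \<open>A relation beside the total function \<open>deriv\<close>, whose value at a point of
  non-differentiability carries no information; derivatives in this form combine by the usual
  rules.\<close>

definition has_dpart ::
  "'v \<Rightarrow> (('v \<Rightarrow> complex) \<Rightarrow> complex) \<Rightarrow> complex \<Rightarrow> ('v \<Rightarrow> complex) \<Rightarrow> bool" where
  "has_dpart t f d x \<longleftrightarrow> ((\<lambda>z. f (x(t := z))) has_field_derivative d) (at (x t))"

lemma has_dpart_imp: "has_dpart t f d x \<Longrightarrow> dpart t f x = d"
  unfolding has_dpart_def dpart_def by (rule DERIV_imp_deriv)

lemma has_dpart_unique: "has_dpart t f d x \<Longrightarrow> has_dpart t f e x \<Longrightarrow> d = e"
  by (metis has_dpart_imp)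

lemma has_dpart_const [simp]: "has_dpart t (\<lambda>x. c) 0 x"
  unfolding has_dpart_def by (auto intro!: derivative_eq_intros)

lemma has_dpart_var: "has_dpart t (\<lambda>x. x v) (if v = t then 1 else 0) x"
  unfolding has_dpart_def by (auto intro!: derivative_eq_intros)

lemma has_dpart_add:
  "has_dpart t f d x \<Longrightarrow> has_dpart t h e x \<Longrightarrow> has_dpart t (\<lambda>x. f x + h x) (d + e) x"
  unfolding has_dpart_def by (auto intro!: derivative_eq_intros)

lemma has_dpart_mult:
  "has_dpart t f d x \<Longrightarrow> has_dpart t h e x \<Longrightarrow>
     has_dpart t (\<lambda>x. f x * h x) (d * h x + f x * e) x"
  unfolding has_dpart_def by (auto intro!: derivative_eq_intros)

lemma has_dpart_sum:
  "(\<And>i. i \<in> S \<Longrightarrow> has_dpart t (f i) (d i) x) \<Longrightarrow>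
     has_dpart t (\<lambda>x. \<Sum>i\<in>S. f i x) (\<Sum>i\<in>S. d i) x"
  by (induction S rule: infinite_finite_induct) (auto intro: has_dpart_add)

lemma has_dpart_power:
  "has_dpart t f d x \<Longrightarrow> has_dpart t (\<lambda>x. f x ^ n) (of_nat n * f x ^ (n - 1) * d) x"
  unfolding has_dpart_def by (auto intro!: derivative_eq_intros)

lemma open_fun_upd_slice:
  fixes U :: "('t \<Rightarrow> complex) set"
  assumes "open U"
  shows "open {z. x(t := z) \<in> U}"
proof -
  have "continuous_on UNIV (\<lambda>z. x(t := z))"
  proof (rule continuous_on_coordinatewise_then_product)
    fix i show "continuous_on UNIV (\<lambda>z. (x(t := z)) i)" by (cases "i = t") auto
  qed
  then have "open ((\<lambda>z. x(t := z)) -` U)"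
    using assms by (rule open_vimage[rotated])
  then show ?thesis by (simp add: vimage_def)
qed

text \<open>An open set has open slices along a coordinate, so partial derivatives are local and an
  identity on an open set may be differentiated.\<close>

lemma has_dpart_cong:
  assumes "open U" "x \<in> U" "\<And>y. y \<in> U \<Longrightarrow> f y = h y"
  shows "has_dpart t f d x \<longleftrightarrow> has_dpart t h d x" "dpart t f x = dpart t h x"
proof -
  have "eventually (\<lambda>z. x(t := z) \<in> U) (nhds (x t))"
    using eventually_nhds_in_open[OF open_fun_upd_slice[OF assms(1)], of "x t" x t] assms(2) by simp
  then have ev: "eventually (\<lambda>z. f (x(t := z)) = h (x(t := z))) (nhds (x t))"
    by (rule eventually_mono) (use assms(3) in auto)
  show "has_dpart t f d x \<longleftrightarrow> has_dpart t h d x"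
    unfolding has_dpart_def by (rule DERIV_cong_ev) (use ev in auto)
  show "dpart t f x = dpart t h x"
    unfolding dpart_def by (rule deriv_cong_ev) (use ev in auto)
qed

text \<open>Differentiating with respect to one of the variables lowers the degree, and the coefficients
  of the derivative are nonzero multiples of the old ones.\<close>

lemma monomials_independent:
  fixes q :: "'m \<Rightarrow> ('t \<Rightarrow> complex) \<Rightarrow> complex" and e :: "'m \<Rightarrow> 'v \<Rightarrow> nat"
  assumes W: "open W" and V: "finite V" "inj_on s V" and M: "finite M"
    and inj: "\<And>k l. k \<in> M \<Longrightarrow> l \<in> M \<Longrightarrow> (\<And>v. v \<in> V \<Longrightarrow> e k v = e l v) \<Longrightarrow> k = l"
    and q: "\<And>k v x. k \<in> M \<Longrightarrow> v \<in> V \<Longrightarrow> x \<in> W \<Longrightarrow> has_dpart (s v) (q k) 0 x"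
    and zero: "\<And>x. x \<in> W \<Longrightarrow> (\<Sum>k\<in>M. q k x * (\<Prod>v\<in>V. x (s v) ^ e k v)) = 0"
    and deg: "\<And>k. k \<in> M \<Longrightarrow> (\<Sum>v\<in>V. e k v) \<le> d"
  shows "\<forall>k\<in>M. \<forall>x\<in>W. q k x = 0"
  using M inj q zero deg
proof (induction d arbitrary: M e q)
  case 0
  have e0: "e k v = 0" if "k \<in> M" "v \<in> V" for k v
    using "0.prems"(5)[OF that(1)] that(2) V(1) by simp
  show ?case
  proof (intro ballI)
    fix k x assume kx: "k \<in> M" "x \<in> W"
    have "M = {k}" using "0.prems"(2) e0 kx by fastforce
    then show "q k x = 0" using "0.prems"(4)[OF kx(2)] e0 kx by simp
  qed
next
  case (Suc d)
  \<comment> \<open>Differentiating in \<open>s v\<close> kills the monomials without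
    \<open>v\<close> and leaves a relation of smaller degree indexed by \<open>M'\<close>, so all
    monomials containing \<open>v\<close> are settled at once.\<close>
  have main: "q k x = 0" if k: "k \<in> M" and v: "v \<in> V" and pos: "e k v > 0" and x: "x \<in> W" for k v x
  proof -
    define M' where "M' = {k \<in> M. e k v > 0}"
    define e' where "e' = (\<lambda>k. (e k)(v := e k v - 1))"
    define q' where "q' = (\<lambda>k x. of_nat (e k v) * q k x)"
    have "\<forall>k\<in>M'. \<forall>x\<in>W. q' k x = 0"
    proof (rule Suc.IH[of M' e' q'])
      show "finite M'" using Suc.prems(1) by (simp add: M'_def)
    next
      fix k l assume kl: "k \<in> M'" "l \<in> M'" "\<And>w. w \<in> V \<Longrightarrow> e' k w = e' l w"
      \<comment> \<open>Lowering the exponent at \<open>v\<close> is injective on \<open>M'\<close>,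
        where this exponent is positive.\<close>
      have "e k w = e l w" if "w \<in> V" for w
        using kl(3)[OF that] kl(1,2) by (cases "w = v") (auto simp: e'_def M'_def)
      then show "k = l" using Suc.prems(2) kl(1,2) by (auto simp: M'_def)
    next
      fix k w x assume "k \<in> M'" "w \<in> V" "x \<in> W"
      then have "has_dpart (s w) (q k) 0 x" using Suc.prems(3) by (auto simp: M'_def)
      from has_dpart_mult[OF has_dpart_const[of _ "of_nat (e k v)"] this]
      show "has_dpart (s w) (q' k) 0 x" by (simp add: q'_def)
    next
      fix x assume x: "x \<in> W"
      have "(\<Sum>k\<in>M. q k x * (of_nat (e k v) * x (s v) ^ (e k v - 1) * (\<Prod>w\<in>V - {v}. x (s w) ^ e k w))) = 0"
      proof -
        have rest: "has_dpart (s v) (\<lambda>x. \<Prod>w\<in>V - {v}. x (s w) ^ e k w) 0 x" for k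
        proof -
          have "(\<Prod>w\<in>V - {v}. (x(s v := z)) (s w) ^ e k w) = (\<Prod>w\<in>V - {v}. x (s w) ^ e k w)" for z
            by (rule prod.cong) (use V(2) v in \<open>auto simp: inj_on_def\<close>)
          then show ?thesis unfolding has_dpart_def by simp
        qed
        have split: "(\<Prod>w\<in>V. x (s w) ^ e k w) = x (s v) ^ e k v * (\<Prod>w\<in>V - {v}. x (s w) ^ e k w)" for k x
          using V(1) v by (rule prod.remove)
        have "has_dpart (s v) (\<lambda>x. \<Sum>k\<in>M. q k x * (x (s v) ^ e k v * (\<Prod>w\<in>V - {v}. x (s w) ^ e k w)))
          (\<Sum>k\<in>M. 0 * (x (s v) ^ e k v * (\<Prod>w\<in>V - {v}. x (s w) ^ e k w)) + q k x *
            (of_nat (e k v) * x (s v) ^ (e k v - 1) * 1 * (\<Prod>w\<in>V - {v}. x (s w) ^ e k w) +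
              x (s v) ^ e k v * 0)) x"
          by (intro has_dpart_sum has_dpart_mult has_dpart_power rest Suc.prems(3) v x)
            (use has_dpart_var[of "s v" "s v" x] in auto)
        moreover have "has_dpart (s v) (\<lambda>x. \<Sum>k\<in>M. q k x * (x (s v) ^ e k v * (\<Prod>w\<in>V - {v}. x (s w) ^ e k w))) 0 x"
          by (subst has_dpart_cong(1)[OF W x, of _ "\<lambda>_. 0"])
            (use Suc.prems(4) in \<open>auto simp: split\<close>)
        ultimately show ?thesis using has_dpart_unique by fastforce
      qed
      also have "(\<Sum>k\<in>M. q k x * (of_nat (e k v) * x (s v) ^ (e k v - 1) * (\<Prod>w\<in>V - {v}. x (s w) ^ e k w))) =
          (\<Sum>k\<in>M'. q' k x * (\<Prod>w\<in>V. x (s w) ^ e' k w))"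
      proof (rule sum.mono_neutral_cong_right)
        fix k assume "k \<in> M'"
        have "(\<Prod>w\<in>V. x (s w) ^ e' k w) = x (s v) ^ e' k v * (\<Prod>w\<in>V - {v}. x (s w) ^ e' k w)"
          using V(1) v by (rule prod.remove)
        also have "(\<Prod>w\<in>V - {v}. x (s w) ^ e' k w) = (\<Prod>w\<in>V - {v}. x (s w) ^ e k w)"
          by (rule prod.cong) (auto simp: e'_def)
        finally show "q k x * (of_nat (e k v) * x (s v) ^ (e k v - 1) * (\<Prod>w\<in>V - {v}. x (s w) ^ e k w))
            = q' k x * (\<Prod>w\<in>V. x (s w) ^ e' k w)"
          by (simp add: q'_def e'_def mult_ac)
      qed (use Suc.prems(1) in \<open>auto simp: M'_def\<close>)
      finally show "(\<Sum>k\<in>M'. q' k x * (\<Prod>w\<in>V. x (s w) ^ e' k w)) = 0" .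
    next
      fix k assume k: "k \<in> M'"
      have "(\<Sum>w\<in>V. e k w) = e k v + (\<Sum>w\<in>V - {v}. e k w)"
        "(\<Sum>w\<in>V. e' k w) = e' k v + (\<Sum>w\<in>V - {v}. e' k w)"
        using V(1) v by (auto intro: sum.remove)
      moreover have "(\<Sum>w\<in>V - {v}. e' k w) = (\<Sum>w\<in>V - {v}. e k w)"
        by (rule sum.cong) (auto simp: e'_def)
      moreover have "(\<Sum>w\<in>V. e k w) \<le> Suc d" "e k v > 0"
        using Suc.prems(5) k by (auto simp: M'_def)
      ultimately show "(\<Sum>w\<in>V. e' k w) \<le> d" by (simp add: e'_def)
    qed
    \<comment> \<open>The factor \<open>e k v\<close> is a positive integer and cancels in
      characteristic zero.\<close>
    then show ?thesis using k pos x by (auto simp: M'_def q'_def)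
  qed
  show ?case
  proof (intro ballI)
    fix k x assume kx: "k \<in> M" "x \<in> W"
    show "q k x = 0"
    proof (cases "\<exists>v\<in>V. e k v > 0")
      case True
      then show ?thesis using main kx by blast
    next
      case False
      \<comment> \<open>All exponents of \<open>k\<close> are zero, hence by injectivity every other
        monomial contains a variable and has its coefficient already known to vanish; the relation
        reduces to \<open>q k x = 0\<close>.\<close>
      have "(\<Sum>l\<in>M. q l x * (\<Prod>v\<in>V. x (s v) ^ e l v)) = (\<Sum>l\<in>{k}. q l x * (\<Prod>v\<in>V. x (s v) ^ e l v))"
      proof (rule sum.mono_neutral_right)
        show "\<forall>l\<in>M - {k}. q l x * (\<Prod>v\<in>V. x (s v) ^ e l v) = 0"
        proof
          fix l assume l: "l \<in> M - {k}"
          then obtain v where "v \<in> V" "e l v \<noteq> e k v" using Suc.prems(2) kx by fastforce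
          then have "e l v > 0" using False by auto
          then show "q l x * (\<Prod>v\<in>V. x (s v) ^ e l v) = 0" using main \<open>v \<in> V\<close> l kx by auto
        qed
      qed (use Suc.prems(1) kx in auto)
      then show ?thesis using Suc.prems(4)[OF kx(2)] False by simp
    qed
  qed
qed

text \<open>Independence of monomials for constant coefficients on the whole space. The degree bound
  \<open>d\<close> is the sum of all degrees, crude but free of a maximum over a possibly empty
  set.\<close>

lemma qpoly_eval_eq_zero:
  fixes P :: "'v qpoly"
  assumes "\<And>x :: 'v \<Rightarrow> complex. qpoly_eval P x = 0"
  shows "P = 0"
proof -
  define V where "V = (\<Union>m\<in>Poly_Mapping.keys P. Poly_Mapping.keys m)"
  define d where "d = (\<Sum>m\<in>Poly_Mapping.keys P. \<Sum>v\<in>V. Poly_Mapping.lookup m v)"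
  have finV: "finite V" by (auto simp: V_def)
  define q where "q = (\<lambda>m (x :: 'v \<Rightarrow> complex). of_rat (Poly_Mapping.lookup P m) :: complex)"
  have "\<forall>m\<in>Poly_Mapping.keys P. \<forall>x\<in>UNIV. q m x = 0"
  proof (rule monomials_independent[where s = id and V = V and e = Poly_Mapping.lookup and d = d])
    fix k l assume kl: "k \<in> Poly_Mapping.keys P" "l \<in> Poly_Mapping.keys P"
      and eq: "\<And>v. v \<in> V \<Longrightarrow> Poly_Mapping.lookup k v = Poly_Mapping.lookup l v"
    show "k = l"
    proof (rule poly_mapping_eqI)
      fix v show "Poly_Mapping.lookup k v = Poly_Mapping.lookup l v"
        by (cases "v \<in> V") (use kl eq in \<open>auto simp: V_def in_keys_iff\<close>)
    qed
  next
    fix x :: "'v \<Rightarrow> complex"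
    have mon: "mon m x = (\<Prod>v\<in>V. x (id v) ^ Poly_Mapping.lookup m v)"
      if "m \<in> Poly_Mapping.keys P" for m
      using that finV by (subst mon_superset[of V]) (auto simp: V_def)
    have "0 = (\<Sum>m\<in>Poly_Mapping.keys P. of_rat (Poly_Mapping.lookup P m) * mon m x)"
      using assms[of x] by (simp add: qpoly_eval_mon)
    also have "\<dots> = (\<Sum>m\<in>Poly_Mapping.keys P. q m x *
        (\<Prod>v\<in>V. x (id v) ^ Poly_Mapping.lookup m v))"
      by (rule sum.cong) (simp_all add: mon q_def)
    finally show "(\<Sum>m\<in>Poly_Mapping.keys P. q m x *
        (\<Prod>v\<in>V. x (id v) ^ Poly_Mapping.lookup m v)) = 0" by simp
  next
    fix k assume "k \<in> Poly_Mapping.keys P"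
    then show "(\<Sum>v\<in>V. Poly_Mapping.lookup k v) \<le> d"
      unfolding d_def by (intro member_le_sum) auto
  qed (use finV in \<open>auto simp: q_def\<close>)
  then have "Poly_Mapping.lookup P m = 0" for m by (auto simp: in_keys_iff q_def)
  then show ?thesis by (intro poly_mapping_eqI) simp
qed

lemma polyfuns_has_dpart:
  "p \<in> polyfuns \<Longrightarrow> \<exists>p'\<in>polyfuns. \<forall>x. has_dpart t p (p' x) x"
proof (induction rule: polyfuns_induct)
  case (var v)
  have "(\<lambda>x. if v = t then 1 else 0) \<in> polyfuns" by (cases "v = t") auto
  moreover have "\<forall>x. has_dpart t (\<lambda>x. x v) (if v = t then 1 else 0) x" by (intro allI has_dpart_var)
  ultimately show ?case by (intro bexI)
next
  case (add p q)
  then obtain p' q' where *: "p' \<in> polyfuns" "\<And>x. has_dpart t p (p' x) x"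
    "q' \<in> polyfuns" "\<And>x. has_dpart t q (q' x) x" by blast
  then show ?case by (intro bexI[of _ "\<lambda>x. p' x + q' x"]) (simp_all add: has_dpart_add * polyfuns_add)
next
  case (mult p q)
  then obtain p' q' where *: "p' \<in> polyfuns" "\<And>x. has_dpart t p (p' x) x"
    "q' \<in> polyfuns" "\<And>x. has_dpart t q (q' x) x" "p \<in> polyfuns" "q \<in> polyfuns" by blast
  then show ?case by (intro bexI[of _ "\<lambda>x. p' x * q x + p x * q' x"])
      (simp_all add: has_dpart_mult * polyfuns_add polyfuns_mult)
next
  case (const c)
  show ?case by (rule bexI[of _ "\<lambda>x. 0"]) simp_all
qed

text \<open>A polynomial mentions finitely many variables; this is the source of the finiteness of
  the sum that defines the derivation.\<close>

lemma polyfuns_finite_support: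
  "p \<in> polyfuns \<Longrightarrow> \<exists>V. finite V \<and> (\<forall>t. t \<notin> V \<longrightarrow> (\<forall>x z. p (x(t := z)) = p x))"
proof (induction rule: polyfuns_induct)
  case (var v)
  show ?case by (rule exI[of _ "{v}"]) auto
next
  case (add p q)
  then obtain V W where "finite V" "\<And>t x z. t \<notin> V \<Longrightarrow> p (x(t := z)) = p x"
    "finite W" "\<And>t x z. t \<notin> W \<Longrightarrow> q (x(t := z)) = q x" by metis
  then show ?case by (intro exI[of _ "V \<union> W"]) (simp del: fun_upd_apply)
next
  case (mult p q)
  then obtain V W where "finite V" "\<And>t x z. t \<notin> V \<Longrightarrow> p (x(t := z)) = p x"
    "finite W" "\<And>t x z. t \<notin> W \<Longrightarrow> q (x(t := z)) = q x" by metis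
  then show ?case by (intro exI[of _ "V \<union> W"]) (simp del: fun_upd_apply)
qed (auto intro!: exI[of _ "{}"])


hide_const (open) up_ring.coeff Polynomials.degree span

section \<open>Algebraic functions\<close>

text \<open>Polynomials in \<open>Z\<close> whose coefficients are polynomial functions, seen fibre
  by fibre. The degree of \<open>C x\<close> may drop at special points \<open>x\<close>.\<close>

definition polyfams :: "(('v \<Rightarrow> complex) \<Rightarrow> complex poly) set" where
  "polyfams = {C. \<forall>i. (\<lambda>x. coeff (C x) i) \<in> polyfuns}"

lemma polyfams_add: "C \<in> polyfams \<Longrightarrow> D \<in> polyfams \<Longrightarrow> (\<lambda>x. C x + D x) \<in> polyfams"
  by (auto simp: polyfams_def)

lemma polyfams_mult: "C \<in> polyfams \<Longrightarrow> D \<in> polyfams \<Longrightarrow> (\<lambda>x. C x * D x) \<in> polyfams"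
  by (auto simp: polyfams_def coeff_mult intro!: polyfuns_sum polyfuns_mult)

lemma polyfams_pCons:
  assumes "p \<in> polyfuns" "C \<in> polyfams"
  shows "(\<lambda>x. pCons (p x) (C x)) \<in> polyfams"
proof -
  have "(\<lambda>x. coeff (pCons (p x) (C x)) i) \<in> polyfuns" for i
    using assms by (cases i) (auto simp: polyfams_def)
  then show ?thesis by (simp add: polyfams_def)
qed

lemma polyfams_0 [simp]: "(\<lambda>x. 0) \<in> polyfams"
  by (simp add: polyfams_def)

lemma polyfams_const: "p \<in> polyfuns \<Longrightarrow> (\<lambda>x. [:p x:]) \<in> polyfams"
  by (intro polyfams_pCons) auto

lemma polyfams_sum: "(\<And>i. i \<in> S \<Longrightarrow> C i \<in> polyfams) \<Longrightarrow> (\<lambda>x. \<Sum>i\<in>S. C i x) \<in> polyfams"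
  by (induction S rule: infinite_finite_induct) (auto intro: polyfams_add)

lemma polyfams_1 [simp]: "(\<lambda>x. 1) \<in> polyfams"
  using polyfams_const[of "\<lambda>x. 1"] by (simp add: one_pCons)

lemma polyfams_prod: "(\<And>i. i \<in> S \<Longrightarrow> C i \<in> polyfams) \<Longrightarrow> (\<lambda>x. \<Prod>i\<in>S. C i x) \<in> polyfams"
  by (induction S rule: infinite_finite_induct) (auto intro: polyfams_mult)

lemma polyfams_of_int [simp]: "(\<lambda>x. of_int k) \<in> polyfams"
  using polyfams_const[of "\<lambda>x. of_int k"] by (simp add: of_int_poly)

text \<open>Terms are sorted by powers of \<open>Z\<close>, the variable \<open>None\<close>. The
  bound \<open>n\<close> is uniform in \<open>x\<close>, so that all fibres can be written as sums
  over one range.\<close>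

lemma polyfuns_option_family:
  assumes "p \<in> polyfuns"
  shows "\<exists>C\<in>polyfams. \<exists>n. \<forall>x. degree (C x) \<le> n \<and> (\<forall>z. p (case_option z x) = poly (C x) z)"
  using assms
proof (induction rule: polyfuns_induct)
  case (const c)
  show ?case by (rule bexI[OF _ polyfams_const[OF polyfuns_const[of c]]]) auto
next
  case (var v)
  show ?case
  proof (cases v)
    case None
    have "(\<lambda>x. [:0, 1:]) \<in> polyfams" by (intro polyfams_pCons polyfams_const) auto
    then show ?thesis by (rule bexI[rotated]) (use None in auto)
  next
    case (Some t)
    show ?thesis by (rule bexI[OF _ polyfams_const[OF polyfuns_var[of t]]]) (use Some in auto)
  qed
next
  case (add p q)
  from add.IH obtain C m D n where CD: "C \<in> polyfams" "D \<in> polyfams"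
    "\<forall>x. degree (C x) \<le> m \<and> (\<forall>z. p (case_option z x) = poly (C x) z)"
    "\<forall>x. degree (D x) \<le> n \<and> (\<forall>z. q (case_option z x) = poly (D x) z)" by blast
  then have *: "\<And>x. degree (C x) \<le> m" "\<And>x z. p (case_option z x) = poly (C x) z"
    "\<And>x. degree (D x) \<le> n" "\<And>x z. q (case_option z x) = poly (D x) z" by auto
  show ?case
    by (rule bexI[OF _ polyfams_add[OF CD(1,2)]], rule exI[of _ "max m n"])
      (use * in \<open>auto intro!: degree_add_le intro: max.coboundedI1 max.coboundedI2\<close>)
next
  case (mult p q)
  from mult.IH obtain C m D n where CD: "C \<in> polyfams" "D \<in> polyfams"
    "\<forall>x. degree (C x) \<le> m \<and> (\<forall>z. p (case_option z x) = poly (C x) z)"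
    "\<forall>x. degree (D x) \<le> n \<and> (\<forall>z. q (case_option z x) = poly (D x) z)" by blast
  then have *: "\<And>x. degree (C x) \<le> m" "\<And>x z. p (case_option z x) = poly (C x) z"
    "\<And>x. degree (D x) \<le> n" "\<And>x z. q (case_option z x) = poly (D x) z" by auto
  have "degree (C x * D x) \<le> m + n" for x
    using degree_mult_le[of "C x" "D x"] *(1)[of x] *(3)[of x] by linarith
  then show ?case
    by (intro bexI[OF _ polyfams_mult[OF CD(1,2)]] exI[of _ "m + n"]) (use * in auto)
qed

text \<open>\<open>a m\<close> may vanish at some points: it plays the role of a nonzero leading
  coefficient over the field of rational functions, and \<open>m\<close> is the degree over that
  field.\<close>

definition annihilates ::
  "('v \<Rightarrow> complex) filter \<Rightarrow> nat \<Rightarrow> (nat \<Rightarrow> ('v \<Rightarrow> complex) \<Rightarrow> complex) \<Rightarrow> (('v \<Rightarrow> complex) \<Rightarrow> complex) \<Rightarrow> bool"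
  where "annihilates F m a f \<longleftrightarrow> (\<forall>i. a i \<in> polyfuns) \<and> (\<exists>x. a m x \<noteq> 0) \<and>
           eventually (\<lambda>x. (\<Sum>i\<le>m. a i x * f x ^ i) = 0) F"

definition alg :: "('v \<Rightarrow> complex) filter \<Rightarrow> (('v \<Rightarrow> complex) \<Rightarrow> complex) \<Rightarrow> bool" where
  "alg F f \<longleftrightarrow> (\<exists>m a. annihilates F m a f)"

text \<open>Top coefficients that are identically zero are dropped, so one coefficient that is
  nonzero somewhere suffices and the true degree need not be known.\<close>

lemma algI_le:
  assumes "\<And>i. i \<le> n \<Longrightarrow> a i \<in> polyfuns" "i \<le> n" "a i x \<noteq> 0"
    and "eventually (\<lambda>x. (\<Sum>i\<le>n. a i x * f x ^ i) = 0) F"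
  shows "alg F f"
proof -
  define m where "m = Max {i. i \<le> n \<and> (\<exists>x. a i x \<noteq> 0)}"
  have "m \<in> {i. i \<le> n \<and> (\<exists>x. a i x \<noteq> 0)}"
    unfolding m_def by (rule Max_in) (use assms in auto)
  moreover have "a i x = 0" if "i \<le> n" "i > m" for i x
  proof (rule ccontr)
    assume "a i x \<noteq> 0"
    then have "i \<le> m" unfolding m_def using that(1) by (intro Max_ge) auto
    with that(2) show False by simp
  qed
  ultimately have m: "m \<le> n" "\<exists>x. a m x \<noteq> 0" "\<And>i x. i \<le> n \<Longrightarrow> i > m \<Longrightarrow> a i x = 0" by auto
  have "(\<Sum>i\<le>n. a i x * f x ^ i) = (\<Sum>i\<le>m. (if i \<le> n then a i x else 0) * f x ^ i)" for x
    by (rule sum.mono_neutral_cong_right) (use m in auto)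
  moreover have "(\<lambda>x. if i \<le> n then a i x else 0) \<in> polyfuns" for i
    using assms(1) by (cases "i \<le> n") auto
  ultimately have "annihilates F m (\<lambda>i x. if i \<le> n then a i x else 0) f"
    using assms(4) m(1,2) unfolding annihilates_def by auto
  then show ?thesis by (auto simp: alg_def)
qed

lemma alg_cong:
  assumes "alg F f" "eventually (\<lambda>x. f x = h x) F"
  shows "alg F h"
proof -
  from assms(1) obtain m a where *: "annihilates F m a f" by (auto simp: alg_def)
  then have "eventually (\<lambda>x. (\<Sum>i\<le>m. a i x * f x ^ i) = 0) F" by (simp add: annihilates_def)
  then have "eventually (\<lambda>x. (\<Sum>i\<le>m. a i x * h x ^ i) = 0) F"
    using assms(2) by eventually_elim simp
  with * have "annihilates F m a h" by (simp add: annihilates_def)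
  then show ?thesis by (auto simp: alg_def)
qed

lemma alg_polyfun:
  assumes "p \<in> polyfuns" shows "alg F p"
proof (rule algI_le)
  show "(if i = 0 then \<lambda>x. - p x else (\<lambda>x. 1)) \<in> polyfuns" for i :: nat
    using assms by auto
  show "eventually (\<lambda>x. (\<Sum>i\<le>1. (if i = 0 then \<lambda>x. - p x else (\<lambda>x. 1)) x * p x ^ i) = 0) F"
    by simp
qed (rule le_refl, simp)

lemma alg_of_qpoly:
  fixes P :: "'v option qpoly"
  assumes "P \<noteq> 0" "eventually (\<lambda>x. qpoly_eval P (case_option (f x) x) = 0) F"
  shows "alg F f"
proof -
  have "qpoly_eval P \<in> polyfuns" by (simp add: polyfuns_def)
  from polyfuns_option_family[OF this] obtain C n where C: "C \<in> polyfams" "\<And>x. degree (C x) \<le> n"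
    "\<And>x z. qpoly_eval P (case_option z x) = poly (C x) z" by blast
  \<comment> \<open>Otherwise \<open>P\<close> would vanish at every point, since a point of the
    option-indexed space splits into its \<open>None\<close> coordinate and the rest.\<close>
  have ex: "\<exists>x. C x \<noteq> 0"
  proof (rule ccontr)
    assume "\<not> ?thesis"
    then have z: "qpoly_eval P (case_option z x) = 0" for x and z :: complex by (simp add: C)
    have "qpoly_eval P y = 0" for y :: "'v option \<Rightarrow> complex"
    proof -
      have "y = case_option (y None) (\<lambda>t. y (Some t))"
        by (auto simp: fun_eq_iff split: option.splits)
      then have "qpoly_eval P y = qpoly_eval P (case_option (y None) (\<lambda>t. y (Some t)))"
        by (rule arg_cong)
      with z show ?thesis by simp
    qed
    then show False using qpoly_eval_eq_zero assms(1) by blast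
  qed
  have pl: "poly (C x) z = (\<Sum>i\<le>n. coeff (C x) i * z ^ i)" for x z
    unfolding poly_altdef by (rule sum.mono_neutral_left) (use C in \<open>auto intro: coeff_eq_0\<close>)
  from ex obtain x0 where "C x0 \<noteq> 0" by blast
  then have lead: "coeff (C x0) (degree (C x0)) \<noteq> 0" by simp
  have ev: "eventually (\<lambda>x. (\<Sum>i\<le>n. coeff (C x) i * f x ^ i) = 0) F"
    using assms(2) by (simp add: C(3) pl)
  show ?thesis
    using C(1) by (intro algI_le[OF _ C(2) lead ev]) (auto simp: polyfams_def)
qed

lemma qpoly_of_annihilator:
  assumes "annihilates F m a f"
  shows "\<exists>P :: 'v option qpoly. P \<noteq> 0 \<and> (\<forall>x z. qpoly_eval P (case_option z x) = (\<Sum>i\<le>m. a i x * z ^ i))"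
proof -
  have ren: "(\<lambda>y. a i (\<lambda>v. y (Some v))) \<in> polyfuns" for i
    using polyfuns_rename[of "a i" Some] assms by (simp add: annihilates_def)
  have "(\<lambda>y. \<Sum>i\<le>m. a i (\<lambda>v. y (Some v)) * y None ^ i) \<in> polyfuns"
    by (intro polyfuns_sum polyfuns_mult polyfuns_power polyfuns_var ren)
  then obtain P where "(\<lambda>y. \<Sum>i\<le>m. a i (\<lambda>v. y (Some v)) * y None ^ i) = qpoly_eval P"
    by (auto simp: polyfuns_def)
  from fun_cong[OF this]
  have P: "qpoly_eval P (case_option z x) = (\<Sum>i\<le>m. a i x * z ^ i)" for x z
    by (rule trans[OF sym]) simp
  have "P \<noteq> 0"
  proof
    assume "P = 0"
    \<comment> \<open>For fixed \<open>x\<close>, a polynomial in \<open>z\<close> with every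
      complex number as a root has zero coefficients, contrary to the choice of
      \<open>a m\<close>.\<close>
    then have "\<forall>z. (\<Sum>i\<le>m. a i x * z ^ i) = 0" for x using P[of _ x] by simp
    then have "a m x = 0" for x using polyfun_eq_0[of "\<lambda>i. a i x" m] by auto
    then show False using assms by (auto simp: annihilates_def)
  qed
  with P show ?thesis by blast
qed

section \<open>Finitely generated modules over the polynomial functions, up to eventual
  equality\<close>

definition span :: "('v \<Rightarrow> complex) filter \<Rightarrow> 'i set \<Rightarrow> ('i \<Rightarrow> ('v \<Rightarrow> complex) \<Rightarrow> complex) \<Rightarrow>
    (('v \<Rightarrow> complex) \<Rightarrow> complex) set" where
  "span F I v = {w. \<exists>c. (\<forall>l\<in>I. c l \<in> polyfuns) \<and> eventually (\<lambda>x. w x = (\<Sum>l\<in>I. c l x * v l x)) F}"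

lemma spanI:
  "(\<And>l. l \<in> I \<Longrightarrow> c l \<in> polyfuns) \<Longrightarrow> eventually (\<lambda>x. w x = (\<Sum>l\<in>I. c l x * v l x)) F \<Longrightarrow> w \<in> span F I v"
  by (auto simp: span_def)

lemma span_cong:
  assumes "w \<in> span F I v" "eventually (\<lambda>x. w' x = w x) F"
  shows "w' \<in> span F I v"
proof -
  from assms(1) obtain c where c: "\<forall>l\<in>I. c l \<in> polyfuns"
    "eventually (\<lambda>x. w x = (\<Sum>l\<in>I. c l x * v l x)) F" by (auto simp: span_def)
  show ?thesis
    by (rule spanI[of I c], use c in force, use c(2) assms(2) in eventually_elim) auto
qed

lemma span_add:
  assumes "w \<in> span F I v" "w' \<in> span F I v"
  shows "(\<lambda>x. w x + w' x) \<in> span F I v"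
proof -
  from assms obtain c c' where c: "\<forall>l\<in>I. c l \<in> polyfuns" "\<forall>l\<in>I. c' l \<in> polyfuns"
    "eventually (\<lambda>x. w x = (\<Sum>l\<in>I. c l x * v l x)) F" "eventually (\<lambda>x. w' x = (\<Sum>l\<in>I. c' l x * v l x)) F"
    by (auto simp: span_def)
  show ?thesis
    by (rule spanI[of I "\<lambda>l x. c l x + c' l x"], use c in force, use c(3,4) in eventually_elim)
      (auto simp: sum.distrib algebra_simps)
qed

lemma span_scale:
  assumes "w \<in> span F I v" "p \<in> polyfuns"
  shows "(\<lambda>x. p x * w x) \<in> span F I v"
proof -
  from assms obtain c where c: "\<forall>l\<in>I. c l \<in> polyfuns"
    "eventually (\<lambda>x. w x = (\<Sum>l\<in>I. c l x * v l x)) F" by (auto simp: span_def)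
  show ?thesis
    by (rule spanI[of I "\<lambda>l x. p x * c l x"], use c assms in force, use c(2) in eventually_elim)
      (auto simp: sum_distrib_left algebra_simps)
qed

lemma span_0: "(\<lambda>x. 0) \<in> span F I v"
  by (rule spanI[of I "\<lambda>l x. 0"]) auto

lemma span_sum:
  assumes "\<And>i. i \<in> S \<Longrightarrow> w i \<in> span F I v"
  shows "(\<lambda>x. \<Sum>i\<in>S. w i x) \<in> span F I v"
  using assms
proof (induction S rule: infinite_finite_induct)
  case (insert i S)
  then show ?case using span_add[OF insert.prems[of i] insert.IH] by simp
qed (simp_all add: span_0)

lemma span_base:
  assumes "finite I" "k \<in> I"
  shows "v k \<in> span F I v"
proof (rule spanI[of I "\<lambda>l x. if l = k then 1 else 0"])
  show "(\<lambda>x. if l = k then 1 else 0) \<in> polyfuns" for l by (cases "l = k") auto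
  show "eventually (\<lambda>x. v k x = (\<Sum>l\<in>I. (if l = k then 1 else 0) * v l x)) F"
  proof -
    have "(\<Sum>l\<in>I. (if l = k then 1 else 0) * v l x) = v k x" for x
      using assms by (subst sum.remove[of I k]) auto
    then show ?thesis by simp
  qed
qed

lemma span_mult:
  assumes "w \<in> span F I v" "\<And>k. k \<in> I \<Longrightarrow> (\<lambda>x. e x * v k x) \<in> span F I v"
  shows "(\<lambda>x. e x * w x) \<in> span F I v"
proof -
  from assms obtain c where c: "\<forall>l\<in>I. c l \<in> polyfuns"
    "eventually (\<lambda>x. w x = (\<Sum>l\<in>I. c l x * v l x)) F" by (auto simp: span_def)
  show ?thesis
  proof (rule span_cong)
    show "(\<lambda>x. \<Sum>l\<in>I. c l x * (e x * v l x)) \<in> span F I v"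
      by (intro span_sum span_scale assms(2)) (use c in auto)
    show "eventually (\<lambda>x. e x * w x = (\<Sum>l\<in>I. c l x * (e x * v l x))) F"
      using c(2) by eventually_elim (simp add: sum_distrib_left mult_ac)
  qed
qed

text \<open>By the Leibniz formula the characteristic polynomial is a polynomial expression in the
  entries, so its coefficients vary polynomially with \<open>x\<close>.\<close>

lemma char_poly_polyfams:
  assumes A: "\<And>x. A x \<in> carrier_mat n n"
    and p: "\<And>i j. i < n \<Longrightarrow> j < n \<Longrightarrow> (\<lambda>x. A x $$ (i, j)) \<in> polyfuns"
  shows "(\<lambda>x. char_poly (A x)) \<in> polyfams"
proof -
  have "char_poly (A x) = (\<Sum>s\<in>{s. s permutes {0..<n}}. of_int (sign s) *
      (\<Prod>i = 0..<n. (if i = s i then [:0, 1:] else 0) + [:- (A x $$ (i, s i)):]))" for x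
  proof -
    have dim: "char_poly_matrix (A x) \<in> carrier_mat n n" using A by simp
    have ent: "char_poly_matrix (A x) $$ (i, j) = (if i = j then [:0, 1:] else 0) + [:- (A x $$ (i, j)):]"
      if "i < n" "j < n" for i j
      using that carrier_matD[OF A[of x]] by (simp add: char_poly_matrix_def)
    have "(\<Prod>i = 0..<n. char_poly_matrix (A x) $$ (i, s i)) =
        (\<Prod>i = 0..<n. (if i = s i then [:0, 1:] else 0) + [:- (A x $$ (i, s i)):])"
      if s: "s permutes {0..<n}" for s
    proof (rule prod.cong[OF refl])
      fix i assume i: "i \<in> {0..<n}"
      then have "s i < n" using permutes_in_image[OF s, of i] by simp
      with i show "char_poly_matrix (A x) $$ (i, s i) =
          (if i = s i then [:0, 1:] else 0) + [:- (A x $$ (i, s i)):]"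
        using ent by simp
    qed
    then show ?thesis
      unfolding char_poly_def det_def'[OF dim] by (intro sum.cong refl) simp
  qed
  moreover have "(\<lambda>x. (if i = s i then [:0, 1:] else 0) + [:- (A x $$ (i, s i)):]) \<in> polyfams"
    if "s permutes {0..<n}" "i < n" for s i
  proof -
    have "s i < n" using permutes_in_image[OF that(1), of i] that(2) by simp
    moreover have "(\<lambda>x. if i = s i then [:0, 1:] else 0) \<in> polyfams"
      by (cases "i = s i") (auto intro!: polyfams_pCons polyfams_const)
    ultimately show ?thesis
      using p[OF that(2)] by (intro polyfams_add polyfams_const polyfuns_uminus)
  qed
  then have "(\<lambda>x. \<Sum>s\<in>{s. s permutes {0..<n}}. of_int (sign s) *
      (\<Prod>i = 0..<n. (if i = s i then [:0, 1:] else 0) + [:- (A x $$ (i, s i)):])) \<in> polyfams"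
    by (intro polyfams_sum polyfams_mult polyfams_prod polyfams_of_int) simp
  ultimately show ?thesis by presburger
qed

text \<open>The interface between algebra and geometry: along such a filter nonzero polynomials
  behave like units, which makes it possible to clear denominators.\<close>

locale generic_filter =
  fixes F :: "('v \<Rightarrow> complex) filter"
  assumes not_bot: "F \<noteq> bot"
    and generic: "p \<in> polyfuns \<Longrightarrow> p x \<noteq> 0 \<Longrightarrow> eventually (\<lambda>x. p x \<noteq> 0) F"
begin

text \<open>A function that maps a finitely generated module over the polynomial functions into itself,
  up to a denominator, is an eigenvalue of a matrix and hence annihilated by its characteristic
  polynomial.\<close>

lemma alg_if_module:
  assumes I: "finite I" and one: "k0 \<in> I" "\<And>x. v k0 x = 1"
    and d: "d \<in> polyfuns" "d x0 \<noteq> 0"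
    and mul: "\<And>k. k \<in> I \<Longrightarrow> (\<lambda>x. d x * u x * v k x) \<in> span F I v"
  shows "alg F u"
proof -
  have "\<forall>k\<in>I. \<exists>c. (\<forall>l\<in>I. c l \<in> polyfuns) \<and>
      eventually (\<lambda>x. d x * u x * v k x = (\<Sum>l\<in>I. c l x * v l x)) F"
    using mul by (simp add: span_def)
  then obtain M where M: "\<And>k l. k \<in> I \<Longrightarrow> l \<in> I \<Longrightarrow> M k l \<in> polyfuns"
    "\<And>k. k \<in> I \<Longrightarrow> eventually (\<lambda>x. d x * u x * v k x = (\<Sum>l\<in>I. M k l x * v l x)) F"
    unfolding bchoice_iff by blast
  define n where "n = card I"
  obtain b where b: "bij_betw b {0..<n} I" using ex_bij_betw_nat_finite[OF I] by (auto simp: n_def)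
  have bI: "b i \<in> I" if "i < n" for i using b that by (auto simp: bij_betw_def)
  define A where "A = (\<lambda>x. Matrix.mat n n (\<lambda>(i, j). M (b i) (b j) x))"
  have A: "A x \<in> carrier_mat n n" for x by (simp add: A_def)
  define C where "C = (\<lambda>x. char_poly (A x))"
  have "C \<in> polyfams"
    unfolding C_def by (rule char_poly_polyfams[OF A]) (auto simp: A_def intro!: M(1) bI)
  have deg: "degree (C x) = n" "coeff (C x) n = 1" for x
    using degree_monic_char_poly[OF A[of x]] by (auto simp: C_def)
  have "eventually (\<lambda>x. \<forall>k\<in>I. d x * u x * v k x = (\<Sum>l\<in>I. M k l x * v l x)) F"
    using M(2) by (intro eventually_ball_finite[OF I]) blast
  \<comment> \<open>\<open>d x * u x\<close> is a root of the characteristic polynomial; the powers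
    of \<open>d\<close> move into the coefficients, which gives an annihilator of \<open>u\<close>
    itself.\<close>
  then have ev: "eventually (\<lambda>x. (\<Sum>i\<le>n. (coeff (C x) i * d x ^ i) * u x ^ i) = 0) F"
  proof eventually_elim
    case (elim x)
    define w where "w = Matrix.vec n (\<lambda>i. v (b i) x)"
    have "eigenvector (A x) w (d x * u x)"
      unfolding eigenvector_def
    proof (intro conjI)
      show "w \<in> carrier_vec (dim_row (A x))" using A[of x] by (simp add: w_def)
      from one(1) b obtain i where i: "i < n" "b i = k0" by (auto simp: bij_betw_def image_iff)
      \<comment> \<open>The generator that is constantly 1 keeps the eigenvector from vanishing at
        any \<open>x\<close>.\<close>
      then have "vec_index w i = 1" by (simp add: w_def one)
      then show "w \<noteq> 0\<^sub>v (dim_row (A x))" using i A[of x] by auto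
      show "A x *\<^sub>v w = (d x * u x) \<cdot>\<^sub>v w"
      proof (rule eq_vecI)
        fix i assume "i < dim_vec ((d x * u x) \<cdot>\<^sub>v w)"
        then have i: "i < n" by (simp add: w_def)
        have "vec_index (A x *\<^sub>v w) i = (\<Sum>j = 0..<n. M (b i) (b j) x * v (b j) x)"
          using i by (simp add: A_def w_def scalar_prod_def)
        also have "\<dots> = (\<Sum>l\<in>I. M (b i) l x * v l x)"
          by (rule sum.reindex_bij_betw[OF b])
        also have "\<dots> = vec_index ((d x * u x) \<cdot>\<^sub>v w) i"
          using elim bI[OF i] i by (simp add: w_def)
        finally show "vec_index (A x *\<^sub>v w) i = vec_index ((d x * u x) \<cdot>\<^sub>v w) i" .
      qed (simp add: A_def w_def)
    qed
    then have "poly (C x) (d x * u x) = 0"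
      using eigenvalue_root_char_poly[OF A[of x]] by (auto simp: eigenvalue_def C_def)
    then show ?case by (simp add: poly_altdef deg power_mult_distrib mult.assoc)
  qed
  show ?thesis
  proof (rule algI_le[OF _ _ _ ev])
    show "(\<lambda>x. coeff (C x) i * d x ^ i) \<in> polyfuns" for i
      using \<open>C \<in> polyfams\<close> d(1) by (auto simp: polyfams_def)
    \<comment> \<open>The characteristic polynomial is monic, so the leading coefficient of the
      annihilator is \<open>d ^ n\<close>.\<close>
    show "coeff (C x0) n * d x0 ^ n \<noteq> 0" using deg d by simp
  qed auto
qed

text \<open>In degree zero a nonzero polynomial would vanish eventually, which a proper generic
  filter excludes.\<close>

lemma annihilates_pos: "annihilates F m a f \<Longrightarrow> m > 0"
proof (rule ccontr)
  assume *: "annihilates F m a f" "\<not> m > 0"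
  then have "eventually (\<lambda>x. a 0 x = 0) F" "eventually (\<lambda>x. a 0 x \<noteq> 0) F"
    using generic by (auto simp: annihilates_def)
  then have "eventually (\<lambda>x. False) F" by eventually_elim simp
  then show False using not_bot by (simp add: eventually_False)
qed

text \<open>Multiplication by \<open>f\<close> shifts a power of \<open>f\<close>; the top power is
  rewritten by the annihilator at the price of the factor \<open>a m\<close>. The spectator
  \<open>r\<close> will be a power of a second function, and \<iota> places the exponent of
  \<open>f\<close> in a larger index set, so that either factor of a mixed product can be
  treated.\<close>

lemma annihilator_span:
  fixes f :: "('v \<Rightarrow> complex) \<Rightarrow> complex"
  assumes f: "annihilates F m a f" and I: "finite I"
    and v: "\<And>i. i < m \<Longrightarrow> \<iota> i \<in> I" "\<And>i x. i < m \<Longrightarrow> v (\<iota> i) x = f x ^ i * r x"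
    and k: "k < m"
  shows "(\<lambda>x. a m x * f x * v (\<iota> k) x) \<in> span F I v"
proof (cases "Suc k < m")
  case True
  have "(\<lambda>x. a m x * v (\<iota> (Suc k)) x) \<in> span F I v"
    using f by (intro span_scale span_base I v True) (auto simp: annihilates_def)
  then show ?thesis
    by (rule span_cong) (use v(2)[OF k] v(2)[OF True] in \<open>simp add: mult_ac\<close>)
next
  case False
  then have m: "m = Suc k" using k by simp
  have "(\<lambda>x. \<Sum>l<m. - a l x * v (\<iota> l) x) \<in> span F I v"
    using f by (intro span_sum span_scale span_base I v) (auto simp: annihilates_def)
  then show ?thesis
  proof (rule span_cong)
    have "eventually (\<lambda>x. (\<Sum>i\<le>m. a i x * f x ^ i) = 0) F"
      using f by (simp add: annihilates_def)
    then show "eventually (\<lambda>x. a m x * f x * v (\<iota> k) x = (\<Sum>l<m. - a l x * v (\<iota> l) x)) F"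
    proof eventually_elim
      case (elim x)
      have "(\<Sum>i<m. a i x * f x ^ i) + a m x * f x ^ m = 0"
        using elim by (simp flip: lessThan_Suc_atMost)
      then have "a m x * f x ^ m = - (\<Sum>l<m. a l x * f x ^ l)"
        by (simp add: add_eq_0_iff)
      then have "a m x * f x ^ m * r x = (\<Sum>l<m. - a l x * (f x ^ l * r x))"
        by (simp add: sum_distrib_right sum_negf mult.assoc)
      then show ?case using v(2) m by (simp add: mult_ac)
    qed
  qed
qed

text \<open>The products \<open>f^i h^j\<close> with exponents below the two degrees generate a
  module that both functions map into itself, up to the denominators \<open>a m\<close> and
  \<open>b n\<close>.\<close>

lemma alg_add_mult:
  assumes "alg F f" "alg F h"
  shows "alg F (\<lambda>x. f x + h x)" "alg F (\<lambda>x. f x * h x)"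
proof -
  from assms obtain m a n b where f: "annihilates F m a f" and h: "annihilates F n b h"
    by (auto simp: alg_def)
  define I where "I = {..<m} \<times> {..<n}"
  define v where "v = (\<lambda>(i, j) x. f x ^ i * h x ^ j)"
  define S where "S = span F I v"
  have fin: "finite I" by (simp add: I_def)
  have one: "(0, 0) \<in> I" "\<And>x. v (0, 0) x = 1"
    using annihilates_pos[OF f] annihilates_pos[OF h] by (auto simp: I_def v_def)
  have vf: "(\<lambda>x. a m x * f x * v k x) \<in> S" if kI: "k \<in> I" for k
  proof -
    obtain i j where k: "k = (i, j)" "i < m" "j < n" using kI unfolding I_def by blast
    show ?thesis unfolding S_def k(1)
      by (rule annihilator_span[OF f fin, of "\<lambda>i. (i, j)" _ "\<lambda>x. h x ^ j"])
        (use k in \<open>simp_all add: I_def v_def\<close>)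
  qed
  have vh: "(\<lambda>x. b n x * h x * v k x) \<in> S" if kI: "k \<in> I" for k
  proof -
    obtain i j where k: "k = (i, j)" "i < m" "j < n" using kI unfolding I_def by blast
    show ?thesis unfolding S_def k(1)
      by (rule annihilator_span[OF h fin, of "\<lambda>j. (i, j)" _ "\<lambda>x. f x ^ i"])
        (use k in \<open>simp_all add: I_def v_def mult.commute\<close>)
  qed
  define d where "d = (\<lambda>x. a m x * b n x)"
  have poly: "a m \<in> polyfuns" "b n \<in> polyfuns" "d \<in> polyfuns"
    using f h by (auto simp: annihilates_def d_def)
  \<comment> \<open>The two leading coefficients may be nonzero at different points; the filter
    provides a common one.\<close>
  obtain x1 x2 where "a m x1 \<noteq> 0" "b n x2 \<noteq> 0"
    using f h unfolding annihilates_def by blast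
  with poly generic have "eventually (\<lambda>x. a m x \<noteq> 0) F" "eventually (\<lambda>x. b n x \<noteq> 0) F" by auto
  then have "eventually (\<lambda>x. d x \<noteq> 0) F" by eventually_elim (simp add: d_def)
  from eventually_happens'[OF not_bot this] obtain x0 where x0: "d x0 \<noteq> 0" ..
  show "alg F (\<lambda>x. f x + h x)"
  proof (rule alg_if_module[OF fin, of _ v, OF one poly(3) x0])
    fix k assume k: "k \<in> I"
    have "(\<lambda>x. b n x * (a m x * f x * v k x) + a m x * (b n x * h x * v k x)) \<in> S"
      using span_add[OF span_scale[OF vf[OF k, unfolded S_def] poly(2)]
          span_scale[OF vh[OF k, unfolded S_def] poly(1)]] unfolding S_def .
    then show "(\<lambda>x. d x * (f x + h x) * v k x) \<in> span F I v"
      unfolding S_def by (rule span_cong) (simp add: d_def algebra_simps)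
  qed
  show "alg F (\<lambda>x. f x * h x)"
  proof (rule alg_if_module[OF fin, of _ v, OF one poly(3) x0])
    fix k assume k: "k \<in> I"
    \<comment> \<open>First \<open>h\<close>, then \<open>f\<close> is applied to a generator, each
      with its own denominator.\<close>
    have "(\<lambda>x. (a m x * f x) * (b n x * h x * v k x)) \<in> S"
      unfolding S_def by (rule span_mult[OF vh[OF k, unfolded S_def] vf[unfolded S_def]])
    then show "(\<lambda>x. d x * (f x * h x) * v k x) \<in> span F I v"
      unfolding S_def by (rule span_cong) (simp add: d_def algebra_simps)
  qed
qed

text \<open>Division of the relation by \<open>f ^ m\<close> reverses the coefficients. The old
  leading coefficient becomes the constant one, so the freedom of the index in
  \<open>algI_le\<close> matters here.\<close>

lemma alg_inverse:
  assumes f: "alg F f" and nz: "eventually (\<lambda>x. f x \<noteq> 0) F"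
  shows "alg F (\<lambda>x. inverse (f x))"
proof -
  from f obtain m a where a: "\<And>i. a i \<in> polyfuns" "\<exists>x. a m x \<noteq> 0"
    "eventually (\<lambda>x. (\<Sum>i\<le>m. a i x * f x ^ i) = 0) F" by (auto simp: alg_def annihilates_def)
  from a(2) obtain x0 where x0: "a m x0 \<noteq> 0" by blast
  show ?thesis
  proof (rule algI_le)
    show "eventually (\<lambda>x. (\<Sum>i\<le>m. a (m - i) x * inverse (f x) ^ i) = 0) F"
      using a(3) nz
    proof eventually_elim
      case (elim x)
      have "(\<Sum>i\<le>m. a (m - i) x * inverse (f x) ^ i) = (\<Sum>i\<le>m. a i x * inverse (f x) ^ (m - i))"
        by (rule sum.reindex_bij_witness[of _ "\<lambda>i. m - i" "\<lambda>i. m - i"]) auto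
      also have "\<dots> = inverse (f x) ^ m * (\<Sum>i\<le>m. a i x * f x ^ i)"
        unfolding sum_distrib_left
        using elim(2) by (intro sum.cong refl) (simp add: power_diff power_inverse divide_inverse)
      finally show ?case using elim(1) by simp
    qed
    show "a (m - 0) x0 \<noteq> 0" using x0 by simp
  qed (use a in auto)
qed

end


section \<open>Holomorphic functions on open subsets of a product of complex lines\<close>

lemma continuous_on_complex_line: "continuous_on S (\<lambda>z :: complex. (\<lambda>t. a t + z * v t))"
  by (intro continuous_on_coordinatewise_then_product continuous_intros)

lemma open_complex_line:
  fixes U :: "('t \<Rightarrow> complex) set"
  assumes "open U" shows "open {z. (\<lambda>t. a t + z * v t) \<in> U}"
  using open_vimage[OF assms continuous_on_complex_line, of a v] by (simp add: vimage_def)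

lemma holomorphic_fun_line:
  "holomorphic_fun f U \<Longrightarrow>
     (\<lambda>z. f (\<lambda>t. a t + z * v t)) holomorphic_on {z. (\<lambda>t. a t + z * v t) \<in> U}"
  by (simp add: holomorphic_fun_def)

lemma holomorphic_fun_subset:
  assumes "holomorphic_fun f U" "V \<subseteq> U" shows "holomorphic_fun f V"
  unfolding holomorphic_fun_def
proof (intro conjI allI)
  show "continuous_on V f"
    using assms by (auto simp: holomorphic_fun_def intro: continuous_on_subset)
  fix a v
  have "{z. (\<lambda>t. a t + z * v t) \<in> V} \<subseteq> {z. (\<lambda>t. a t + z * v t) \<in> U}"
    using assms(2) by blast
  with assms(1) show "(\<lambda>z. f (\<lambda>t. a t + z * v t)) holomorphic_on {z. (\<lambda>t. a t + z * v t) \<in> V}"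
    unfolding holomorphic_fun_def using holomorphic_on_subset by blast
qed

lemma holomorphic_fun_cong:
  assumes "\<And>x. x \<in> U \<Longrightarrow> f x = h x"
  shows "holomorphic_fun f U \<longleftrightarrow> holomorphic_fun h U"
proof -
  have "continuous_on U f \<longleftrightarrow> continuous_on U h"
    by (rule continuous_on_cong) (use assms in auto)
  moreover have "(\<lambda>z. f (\<lambda>t. a t + z * v t)) holomorphic_on {z. (\<lambda>t. a t + z * v t) \<in> U} \<longleftrightarrow>
     (\<lambda>z. h (\<lambda>t. a t + z * v t)) holomorphic_on {z. (\<lambda>t. a t + z * v t) \<in> U}" for a v
    by (rule holomorphic_cong) (use assms in auto)
  ultimately show ?thesis by (simp add: holomorphic_fun_def)
qed

lemma holomorphic_fun_const: "holomorphic_fun (\<lambda>x. c) U"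
  unfolding holomorphic_fun_def by (intro conjI allI continuous_intros holomorphic_intros)

lemma holomorphic_fun_var: "holomorphic_fun (\<lambda>x. x t) U"
  unfolding holomorphic_fun_def
  by (intro conjI allI holomorphic_intros continuous_on_subset[OF continuous_on_product_coordinates]) simp

lemma holomorphic_fun_add:
  "holomorphic_fun f U \<Longrightarrow> holomorphic_fun h U \<Longrightarrow> holomorphic_fun (\<lambda>x. f x + h x) U"
  unfolding holomorphic_fun_def by (auto intro: continuous_on_add holomorphic_on_add)

lemma holomorphic_fun_mult:
  "holomorphic_fun f U \<Longrightarrow> holomorphic_fun h U \<Longrightarrow> holomorphic_fun (\<lambda>x. f x * h x) U"
  unfolding holomorphic_fun_def by (auto intro: continuous_on_mult holomorphic_on_mult)

lemma holomorphic_fun_inverse: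
  "holomorphic_fun f U \<Longrightarrow> (\<And>x. x \<in> U \<Longrightarrow> f x \<noteq> 0) \<Longrightarrow> holomorphic_fun (\<lambda>x. inverse (f x)) U"
  unfolding holomorphic_fun_def by (auto intro!: continuous_on_inverse holomorphic_on_inverse)

lemma holomorphic_fun_polyfun: "p \<in> polyfuns \<Longrightarrow> holomorphic_fun p U"
  by (induction rule: polyfuns_induct)
    (simp_all add: holomorphic_fun_const holomorphic_fun_var holomorphic_fun_add holomorphic_fun_mult)

lemma holomorphic_fun_has_dpart:
  assumes "holomorphic_fun f U" "open U" "x \<in> U"
  shows "has_dpart t f (dpart t f x) x"
proof -
  \<comment> \<open>The coordinate slice is the complex line through \<open>x(t := 0)\<close> in
    direction \<open>t\<close>, parametrized so that \<open>z\<close> is the new value of the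
    coordinate.\<close>
  let ?a = "x(t := 0)" and ?v = "\<lambda>s. if s = t then 1 else 0"
  have line: "(\<lambda>s. ?a s + z * ?v s) = x(t := z)" for z :: complex by auto
  have "(\<lambda>z. f (x(t := z))) holomorphic_on {z. x(t := z) \<in> U}"
    using holomorphic_fun_line[OF assms(1), of ?a ?v] unfolding line .
  moreover have "open {z. x(t := z) \<in> U}" using assms(2) by (rule open_fun_upd_slice)
  moreover have "x t \<in> {z. x(t := z) \<in> U}" using assms(3) by simp
  ultimately show ?thesis
    unfolding has_dpart_def dpart_def by (rule holomorphic_derivI)
qed

text \<open>The box is a product of discs in finitely many coordinates and full planes in the
  others. Convexity is stated for the parameter sets of complex lines, because the one-variable
  identity theorem is applied there.\<close>

lemma open_contains_convex_box:
  fixes U :: "('t \<Rightarrow> complex) set"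
  assumes "open U" "x \<in> U"
  obtains B where "open B" "x \<in> B" "B \<subseteq> U"
    "\<And>y w. convex {z. (\<lambda>t. y t + z * w t) \<in> B}"
proof -
  from product_topology_open_contains_basis[OF assms(1)[unfolded open_fun_def] assms(2)]
  obtain Y where Y': "x \<in> Pi\<^sub>E UNIV Y" "\<forall>t. openin euclidean (Y t)"
    "finite {t. Y t \<noteq> topspace euclidean}" "Pi\<^sub>E UNIV Y \<subseteq> U"
    by (elim exE conjE) (rule that)
  have Y: "x t \<in> Y t" "open (Y t)" "finite {t. Y t \<noteq> UNIV}" for t
    using PiE_mem[OF Y'(1), of t] Y'(2,3) by simp_all
  \<comment> \<open>An unrestricted coordinate must stay unrestricted: a product of infinitely many
    discs is not open.\<close>
  have "\<exists>b. open b \<and> x t \<in> b \<and> b \<subseteq> Y t \<and> convex b \<and> (Y t = UNIV \<longrightarrow> b = UNIV)" for t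
  proof (cases "Y t = UNIV")
    case True
    then show ?thesis by (intro exI[of _ UNIV]) auto
  next
    case False
    obtain e where "e > 0" "ball (x t) e \<subseteq> Y t" using Y(1,2) open_contains_ball by blast
    then show ?thesis using False by (intro exI[of _ "ball (x t) e"]) auto
  qed
  then obtain b where b: "\<And>t. open (b t)" "\<And>t. x t \<in> b t" "\<And>t. b t \<subseteq> Y t" "\<And>t. convex (b t)"
    "\<And>t. Y t = UNIV \<Longrightarrow> b t = UNIV" by metis
  show ?thesis
  proof
    have "{t. b t \<noteq> UNIV} \<subseteq> {t. Y t \<noteq> UNIV}" using b(5) by blast
    then have "finite {t. b t \<noteq> UNIV}" using Y(3) by (rule finite_subset)
    with b(1) show "open (Pi\<^sub>E UNIV b)" by (rule open_PiE)
    show "x \<in> Pi\<^sub>E UNIV b" using b(2) by auto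
    show "Pi\<^sub>E UNIV b \<subseteq> U" by (rule order_trans[OF PiE_mono[OF b(3)] Y'(4)])
    fix y w :: "'t \<Rightarrow> complex"
    show "convex {z. (\<lambda>t. y t + z * w t) \<in> Pi\<^sub>E UNIV b}"
    proof (rule convexI)
      fix z z' :: complex and u u' :: real
      assume z: "z \<in> {z. (\<lambda>t. y t + z * w t) \<in> Pi\<^sub>E UNIV b}" "z' \<in> {z. (\<lambda>t. y t + z * w t) \<in> Pi\<^sub>E UNIV b}"
        and u: "0 \<le> u" "0 \<le> u'" "u + u' = 1"
      have "y t + (u *\<^sub>R z + u' *\<^sub>R z') * w t \<in> b t" for t
      proof -
        have "u *\<^sub>R (y t + z * w t) + u' *\<^sub>R (y t + z' * w t) \<in> b t"
          using z u by (intro convexD[OF b(4)]) (auto simp: PiE_iff)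
        also have "u *\<^sub>R (y t + z * w t) + u' *\<^sub>R (y t + z' * w t) =
            (u + u') *\<^sub>R y t + (u *\<^sub>R z + u' *\<^sub>R z') * w t"
          by (simp add: algebra_simps)
        finally show ?thesis using u by simp
      qed
      then show "u *\<^sub>R z + u' *\<^sub>R z' \<in> {z. (\<lambda>t. y t + z * w t) \<in> Pi\<^sub>E UNIV b}"
        by (simp add: PiE_iff)
    qed
  qed
qed

text \<open>The largest open set \<open>Z\<close> of zeros is relatively closed in \<open>U\<close>:
  a box that meets \<open>Z\<close> lies in \<open>Z\<close>, since each of its points is joined to
  a point of \<open>Z\<close> by a complex line to which the one-variable identity theorem
  applies.\<close>

lemma holomorphic_fun_identity:
  fixes U :: "('t \<Rightarrow> complex) set"
  assumes f: "holomorphic_fun f U" and U: "open U" "connected U"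
    and V: "open V" "V \<noteq> {}" "V \<subseteq> U" "\<And>x. x \<in> V \<Longrightarrow> f x = 0" and x: "x \<in> U"
  shows "f x = 0"
proof -
  define Z where "Z = \<Union>{N. open N \<and> N \<subseteq> U \<and> (\<forall>y\<in>N. f y = 0)}"
  have Z: "open Z" "Z \<subseteq> U" "\<And>y. y \<in> Z \<Longrightarrow> f y = 0" "V \<subseteq> Z"
    using V by (auto simp: Z_def)
  have "open (U - Z)"
  proof (subst open_subopen, intro ballI)
    fix x assume x: "x \<in> U - Z"
    obtain B where B: "open B" "x \<in> B" "B \<subseteq> U" "\<And>y w. convex {z. (\<lambda>t. y t + z * w t) \<in> B}"
      using open_contains_convex_box[OF U(1), of x] x by blast
    have "B \<inter> Z = {}"
    proof (rule ccontr)
      assume "B \<inter> Z \<noteq> {}"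
      then obtain y where y: "y \<in> B" "y \<in> Z" by blast
      have "f y' = 0" if y': "y' \<in> B" for y'
      proof -
        define l where "l = (\<lambda>z. (\<lambda>t. y t + z * (y' t - y t)))"
        have l01: "l 0 = y" "l 1 = y'" by (auto simp: l_def)
        have op: "open {z. l z \<in> B}" "open {z. l z \<in> B \<inter> Z}"
          unfolding l_def by (intro open_complex_line open_Int B Z)+
        have "(\<lambda>z. f (l z)) holomorphic_on {z. l z \<in> B}"
          using holomorphic_fun_line[OF holomorphic_fun_subset[OF f B(3)], of y "\<lambda>t. y' t - y t"]
          by (simp only: l_def)
        moreover have "connected {z. l z \<in> B}"
          unfolding l_def by (intro convex_connected B(4))
        moreover have "{z. l z \<in> B \<inter> Z} \<noteq> {}" using l01(1) y by blast
        moreover have "(1 :: complex) \<in> {z. l z \<in> B}" using l01(2) y' by simp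
        ultimately have "f (l 1) = 0"
          using analytic_continuation_open[OF op(2,1), of "\<lambda>z. f (l z)" "\<lambda>_. 0" 1] Z(3)
          by (simp add: subset_iff)
        with l01 show ?thesis by simp
      qed
      with B have "B \<subseteq> Z" by (auto simp: Z_def)
      with B x show False by blast
    qed
    with B show "\<exists>T. open T \<and> x \<in> T \<and> T \<subseteq> U - Z" by blast
  qed
  with Z(1) U(2) have "Z \<inter> U = {} \<or> (U - Z) \<inter> U = {}"
    by (intro connectedD) auto
  with V Z x show ?thesis by blast
qed

text \<open>If \<open>h\<close> is nonzero at a point, then by continuity on an open set;
  \<open>f\<close> vanishes there and hence on all of \<open>U\<close>.\<close>

lemma holomorphic_fun_no_zero_divisors:
  assumes f: "holomorphic_fun f U" and h: "holomorphic_fun h U" and U: "open U" "connected U"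
    and fh: "\<And>x. x \<in> U \<Longrightarrow> f x * h x = 0"
  shows "(\<forall>x\<in>U. f x = 0) \<or> (\<forall>x\<in>U. h x = 0)"
proof (rule disjCI)
  assume "\<not> (\<forall>x\<in>U. h x = 0)"
  then obtain x where x: "x \<in> U" "h x \<noteq> 0" by blast
  have cont: "continuous_on U h" using h by (simp add: holomorphic_fun_def)
  define V where "V = h -` (- {0}) \<inter> U"
  have "open V" unfolding V_def using cont U(1) by (auto simp: continuous_on_open_vimage)
  moreover have "x \<in> V" "V \<subseteq> U" using x by (auto simp: V_def)
  moreover have "f y = 0" if "y \<in> V" for y using fh[of y] that by (auto simp: V_def)
  ultimately show "\<forall>x\<in>U. f x = 0"
    using holomorphic_fun_identity[OF f U, of V] by blast
qed


section \<open>Germs along a c-filter\<close>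

text \<open>Statements about some member of \<Omega> become eventual ones, so that shrinking of
  domains is left to filter reasoning.\<close>

definition nash_filter :: "('t \<Rightarrow> complex) set set \<Rightarrow> ('t \<Rightarrow> complex) filter" where
  "nash_filter \<Omega> = (INF U\<in>\<Omega>. principal U)"

locale nash =
  fixes \<Omega> :: "('t \<Rightarrow> complex) set set"
  assumes c_filter: "c_filter \<Omega>"
begin

abbreviation "F \<equiv> nash_filter \<Omega>"
abbreviation "K \<equiv> nash_field \<Omega>"
abbreviation "germ \<equiv> nash_of_fun \<Omega>"

lemma \<Omega>_open: "U \<in> \<Omega> \<Longrightarrow> open U" and \<Omega>_connected: "U \<in> \<Omega> \<Longrightarrow> connected U"
  and \<Omega>_nonempty: "U \<in> \<Omega> \<Longrightarrow> U \<noteq> {}"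
  using c_filter by (auto simp: c_filter_def)

lemma \<Omega>_avoid: "Q_algebraic V \<Longrightarrow> V \<noteq> UNIV \<Longrightarrow> \<exists>U\<in>\<Omega>. V \<inter> U = {}"
  using c_filter unfolding c_filter_def by blast

lemma \<Omega>_directed: "U \<in> \<Omega> \<Longrightarrow> V \<in> \<Omega> \<Longrightarrow> \<exists>W\<in>\<Omega>. W \<subseteq> U \<inter> V"
  using c_filter unfolding c_filter_def by blast

lemma polyfun_avoid:
  assumes "p \<in> polyfuns" "p x \<noteq> 0" shows "\<exists>U\<in>\<Omega>. \<forall>x\<in>U. p x \<noteq> 0"
proof -
  from assms(1) obtain P where P: "p = qpoly_eval P" by (auto simp: polyfuns_def)
  have "Q_algebraic {x. p x = 0}"
    unfolding Q_algebraic_def by (rule exI[of _ "{P}"]) (simp add: P)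
  moreover have "{x. p x = 0} \<noteq> UNIV" using assms(2) by blast
  ultimately obtain U where "U \<in> \<Omega>" "{x. p x = 0} \<inter> U = {}" using \<Omega>_avoid by blast
  then show ?thesis by (intro bexI[of _ U]) auto
qed

lemma eventually_nash: "eventually P F \<longleftrightarrow> (\<exists>U\<in>\<Omega>. \<forall>x\<in>U. P x)"
proof -
  \<comment> \<open>Condition (ii) for the empty algebraic set, the zero set of the polynomial 1,
    yields a member.\<close>
  have "\<Omega> \<noteq> {}" using polyfun_avoid[of "\<lambda>_. 1"] by auto
  then have "eventually P F \<longleftrightarrow> (\<exists>U\<in>\<Omega>. eventually P (principal U))"
    unfolding nash_filter_def
  proof (rule eventually_INF_base)
    fix U V assume "U \<in> \<Omega>" "V \<in> \<Omega>"
    then show "\<exists>W\<in>\<Omega>. principal W \<le> inf (principal U) (principal V)"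
      using \<Omega>_directed by (simp add: inf_principal)
  qed
  then show ?thesis by (simp add: eventually_principal)
qed

sublocale generic_filter F
proof
  show "F \<noteq> bot"
    using eventually_nash[of "\<lambda>_. False"] \<Omega>_nonempty by (auto simp: eventually_False[symmetric])
  show "eventually (\<lambda>x. p x \<noteq> 0) F" if "p \<in> polyfuns" "p x \<noteq> 0" for p x
    using polyfun_avoid[OF that] by (simp add: eventually_nash)
qed

text \<open>For the definitions of germs and their operations, which ask for a witness inside a
  prescribed domain.\<close>

lemma eventually_nash_subset:
  assumes "eventually P F" "V \<in> \<Omega>"
  obtains W where "W \<in> \<Omega>" "W \<subseteq> V" "\<And>x. x \<in> W \<Longrightarrow> P x"
proof -
  from assms(1) obtain U where U: "U \<in> \<Omega>" "\<And>x. x \<in> U \<Longrightarrow> P x" by (auto simp: eventually_nash)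
  from \<Omega>_directed[OF U(1) assms(2)] U(2) show ?thesis by (auto intro: that)
qed

section \<open>Nash functions as total functions modulo the filter\<close>

definition is_nash :: "(('t \<Rightarrow> complex) \<Rightarrow> complex) \<Rightarrow> bool" where
  "is_nash f \<longleftrightarrow> (\<exists>U\<in>\<Omega>. f \<in> nash_functions U)"

text \<open>Separates algebra from analysis, so that closure properties can be proved for each part
  alone. The two parts may hold on different members; directedness gives a common one.\<close>

lemma is_nash_iff: "is_nash f \<longleftrightarrow> alg F f \<and> (\<exists>U\<in>\<Omega>. holomorphic_fun f U)"
proof
  assume "is_nash f"
  then obtain U and P :: "'t option qpoly" where U: "U \<in> \<Omega>" "holomorphic_fun f U"
    "P \<noteq> 0" "\<forall>x\<in>U. qpoly_eval P (case_option (f x) x) = 0"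
    by (auto simp: is_nash_def nash_functions_def)
  then have "eventually (\<lambda>x. qpoly_eval P (case_option (f x) x) = 0) F"
    by (auto simp: eventually_nash)
  with U alg_of_qpoly show "alg F f \<and> (\<exists>U\<in>\<Omega>. holomorphic_fun f U)" by blast
next
  assume "alg F f \<and> (\<exists>U\<in>\<Omega>. holomorphic_fun f U)"
  then obtain m a U where a: "annihilates F m a f" and U: "U \<in> \<Omega>" "holomorphic_fun f U"
    by (auto simp: alg_def)
  have "eventually (\<lambda>x. (\<Sum>i\<le>m. a i x * f x ^ i) = 0) F"
    using a by (simp add: annihilates_def)
  from eventually_nash_subset[OF this U(1)]
  obtain W where W: "W \<in> \<Omega>" "W \<subseteq> U" "\<And>x. x \<in> W \<Longrightarrow> (\<Sum>i\<le>m. a i x * f x ^ i) = 0" by blast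
  from qpoly_of_annihilator[OF a] obtain P :: "'t option qpoly"
    where P: "P \<noteq> 0" "\<forall>x z. qpoly_eval P (case_option z x) = (\<Sum>i\<le>m. a i x * z ^ i)" by blast
  have "f \<in> nash_functions W"
    unfolding nash_functions_def using holomorphic_fun_subset[OF U(2) W(2)] P W(3) by auto
  with W(1) show "is_nash f" by (auto simp: is_nash_def)
qed

lemma is_nash_representative:
  assumes "is_nash f" "eventually P F"
  obtains U where "U \<in> \<Omega>" "f \<in> nash_functions U" "\<And>x. x \<in> U \<Longrightarrow> P x"
proof -
  from assms(1) obtain V where V: "V \<in> \<Omega>" "f \<in> nash_functions V" by (auto simp: is_nash_def)
  from eventually_nash_subset[OF assms(2) V(1)] obtain W
    where W: "W \<in> \<Omega>" "W \<subseteq> V" "\<And>x. x \<in> W \<Longrightarrow> P x" by blast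
  moreover have "f \<in> nash_functions W"
    using V(2) W(2) holomorphic_fun_subset unfolding nash_functions_def by blast
  ultimately show ?thesis using that by blast
qed

lemma is_nash_holomorphic:
  assumes "is_nash f" "eventually P F"
  obtains U where "U \<in> \<Omega>" "holomorphic_fun f U" "\<And>x. x \<in> U \<Longrightarrow> P x"
proof -
  obtain U where "U \<in> \<Omega>" "f \<in> nash_functions U" "\<And>x. x \<in> U \<Longrightarrow> P x"
    using is_nash_representative[OF assms] by blast
  then show ?thesis by (intro that[of U]) (auto simp: nash_functions_def)
qed

lemma is_nash_cong:
  assumes "is_nash f" "eventually (\<lambda>x. f x = h x) F"
  shows "is_nash h"
proof -
  obtain U where "U \<in> \<Omega>" "holomorphic_fun f U" "\<And>x. x \<in> U \<Longrightarrow> f x = h x"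
    using is_nash_holomorphic[OF assms] by blast
  moreover from this have "holomorphic_fun h U" using holomorphic_fun_cong by metis
  moreover have "alg F h" using assms alg_cong by (auto simp: is_nash_iff)
  ultimately show ?thesis by (auto simp: is_nash_iff)
qed

lemma is_nash_polyfun: "p \<in> polyfuns \<Longrightarrow> is_nash p"
  using polyfun_avoid[of "\<lambda>_. 1"] by (auto simp: is_nash_iff alg_polyfun holomorphic_fun_polyfun)

lemma is_nash_add_mult:
  assumes "is_nash f" "is_nash h"
  shows is_nash_add: "is_nash (\<lambda>x. f x + h x)" and is_nash_mult: "is_nash (\<lambda>x. f x * h x)"
proof -
  from assms obtain U V where UV: "U \<in> \<Omega>" "holomorphic_fun f U" "V \<in> \<Omega>" "holomorphic_fun h V"
    by (auto simp: is_nash_iff)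
  then obtain W where W: "W \<in> \<Omega>" "W \<subseteq> U" "W \<subseteq> V" using \<Omega>_directed[of U V] by auto
  with UV have fh: "holomorphic_fun f W" "holomorphic_fun h W"
    using holomorphic_fun_subset by blast+
  show "is_nash (\<lambda>x. f x + h x)"
    using holomorphic_fun_add[OF fh] alg_add_mult(1)[of f h] W(1) assms by (auto simp: is_nash_iff)
  show "is_nash (\<lambda>x. f x * h x)"
    using holomorphic_fun_mult[OF fh] alg_add_mult(2)[of f h] W(1) assms by (auto simp: is_nash_iff)
qed

lemma is_nash_const [simp]: "is_nash (\<lambda>x. 0)" "is_nash (\<lambda>x. 1)" "is_nash (\<lambda>x. of_nat n)"
  "is_nash (\<lambda>x. - 1)" "is_nash (\<lambda>x. x t)"
  by (simp_all add: is_nash_polyfun)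

lemma is_nash_uminus: "is_nash f \<Longrightarrow> is_nash (\<lambda>x. - f x)"
  using is_nash_mult[OF is_nash_const(4), of f] by simp

lemma is_nash_sum:
  assumes "\<And>i. i \<in> S \<Longrightarrow> is_nash (f i)" shows "is_nash (\<lambda>x. \<Sum>i\<in>S. f i x)"
  using assms
proof (induction S rule: infinite_finite_induct)
  case (insert i S)
  then show ?case using is_nash_add[OF insert.prems[of i] insert.IH] by simp
qed simp_all

lemma is_nash_prod:
  assumes "\<And>i. i \<in> S \<Longrightarrow> is_nash (f i)" shows "is_nash (\<lambda>x. \<Prod>i\<in>S. f i x)"
  using assms
proof (induction S rule: infinite_finite_induct)
  case (insert i S)
  then show ?case using is_nash_mult[OF insert.prems[of i] insert.IH] by simp
qed simp_all

lemma is_nash_power: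
  assumes "is_nash f" shows "is_nash (\<lambda>x. f x ^ n)"
proof (induction n)
  case (Suc n)
  show ?case using is_nash_mult[OF assms Suc.IH] by simp
qed simp

text \<open>Members of \<Omega> are open and connected, so the identity theorem works on a common
  domain of \<open>f\<close> and \<open>h\<close>.\<close>

lemma is_nash_zero_divisors:
  assumes f: "is_nash f" and h: "is_nash h" and fh: "eventually (\<lambda>x. f x * h x = 0) F"
  shows "eventually (\<lambda>x. f x = 0) F \<or> eventually (\<lambda>x. h x = 0) F"
proof -
  from h obtain V where V: "V \<in> \<Omega>" "holomorphic_fun h V" by (auto simp: is_nash_iff)
  obtain U where U: "U \<in> \<Omega>" "holomorphic_fun f U" "\<And>x. x \<in> U \<Longrightarrow> f x * h x = 0"
    using is_nash_holomorphic[OF f fh] by blast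
  obtain W where W: "W \<in> \<Omega>" "W \<subseteq> U" "W \<subseteq> V" using \<Omega>_directed[OF U(1) V(1)] by auto
  have "(\<forall>x\<in>W. f x = 0) \<or> (\<forall>x\<in>W. h x = 0)"
    by (rule holomorphic_fun_no_zero_divisors[OF holomorphic_fun_subset[OF U(2) W(2)]
          holomorphic_fun_subset[OF V(2) W(3)] \<Omega>_open[OF W(1)] \<Omega>_connected[OF W(1)]])
      (use U(3) W(2) in auto)
  with W(1) show ?thesis by (auto simp: eventually_nash)
qed

text \<open>Cancelling powers of \<open>f\<close> in an annihilating polynomial leads to one with nonzero constant
  term, unless \<open>f\<close> vanishes; then \<open>f\<close> has no zeros off the zero set of that term.\<close>

lemma is_nash_dichotomy:
  assumes f: "is_nash f"
  shows "eventually (\<lambda>x. f x = 0) F \<or> eventually (\<lambda>x. f x \<noteq> 0) F"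
proof -
  from f obtain m a where "annihilates F m a f" by (auto simp: is_nash_iff alg_def)
  then show ?thesis
  proof (induction m arbitrary: a)
    case 0
    then show ?case using annihilates_pos by blast
  next
    case (Suc m)
    have a: "a i \<in> polyfuns" for i using Suc.prems by (simp add: annihilates_def)
    have ev: "eventually (\<lambda>x. (\<Sum>i\<le>Suc m. a i x * f x ^ i) = 0) F"
      using Suc.prems by (simp add: annihilates_def)
    show ?case
    proof (cases "\<exists>x. a 0 x \<noteq> 0")
      case True
      then have "eventually (\<lambda>x. a 0 x \<noteq> 0) F" using generic a by blast
      \<comment> \<open>At a zero of \<open>f\<close> the relation would reduce to
        \<open>a 0 x = 0\<close>.\<close>
      then have "eventually (\<lambda>x. f x \<noteq> 0) F"
        using ev
      proof eventually_elim
        case (elim x)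
        have "(\<Sum>i\<le>Suc m. a i x * f x ^ i) = a 0 x + (\<Sum>i\<le>m. a (Suc i) x * f x ^ Suc i)"
          by (subst sum.atMost_Suc_shift) simp
        with elim show ?case by auto
      qed
      then show ?thesis ..
    next
      case False
      \<comment> \<open>With \<open>a 0\<close> identically zero the relation reads
        \<open>f * h = 0\<close>. One factor vanishes, and vanishing of \<open>h\<close> is an
        annihilation of degree \<open>m\<close>.\<close>
      define h where "h = (\<lambda>x. \<Sum>i\<le>m. a (Suc i) x * f x ^ i)"
      have "(\<Sum>i\<le>Suc m. a i x * f x ^ i) = f x * h x" for x
        using False by (subst sum.atMost_Suc_shift) (simp add: h_def sum_distrib_left mult_ac)
      then have "eventually (\<lambda>x. f x * h x = 0) F" using ev by simp
      moreover have "is_nash h"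
        unfolding h_def by (intro is_nash_sum is_nash_mult is_nash_power is_nash_polyfun f a)
      ultimately have "eventually (\<lambda>x. f x = 0) F \<or> eventually (\<lambda>x. h x = 0) F"
        using is_nash_zero_divisors f by blast
      then show ?thesis
      proof
        assume "eventually (\<lambda>x. h x = 0) F"
        then have "annihilates F m (\<lambda>i. a (Suc i)) f"
          using Suc.prems by (simp add: annihilates_def h_def)
        then show ?thesis by (rule Suc.IH)
      qed simp
    qed
  qed
qed

lemma is_nash_inverse:
  assumes "is_nash f" shows "is_nash (\<lambda>x. inverse (f x))"
  using is_nash_dichotomy[OF assms]
proof
  assume "eventually (\<lambda>x. f x = 0) F"
  \<comment> \<open>\<open>inverse 0 = 0\<close>, so the inverse of an eventually zero function is
    again eventually zero.\<close>
  then have "eventually (\<lambda>x. 0 = inverse (f x)) F" by eventually_elim simp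
  then show ?thesis using is_nash_cong[OF is_nash_const(1)] by simp
next
  assume nz: "eventually (\<lambda>x. f x \<noteq> 0) F"
  obtain U where "U \<in> \<Omega>" "holomorphic_fun f U" "\<And>x. x \<in> U \<Longrightarrow> f x \<noteq> 0"
    using is_nash_holomorphic[OF assms nz] by blast
  moreover have "alg F (\<lambda>x. inverse (f x))" using assms nz alg_inverse by (auto simp: is_nash_iff)
  ultimately show ?thesis using holomorphic_fun_inverse by (auto simp: is_nash_iff)
qed

section \<open>Germs and the field structure\<close>

lemma mem_germ:
  "(V, h) \<in> germ f \<longleftrightarrow> V \<in> \<Omega> \<and> h \<in> nash_functions V \<and> eventually (\<lambda>x. h x = f x) F"
proof
  assume "(V, h) \<in> germ f"
  then show "V \<in> \<Omega> \<and> h \<in> nash_functions V \<and> eventually (\<lambda>x. h x = f x) F"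
    by (auto simp: nash_of_fun_def nash_pairs_def eventually_nash)
next
  assume *: "V \<in> \<Omega> \<and> h \<in> nash_functions V \<and> eventually (\<lambda>x. h x = f x) F"
  then obtain W where "W \<in> \<Omega>" "W \<subseteq> V" "\<And>x. x \<in> W \<Longrightarrow> h x = f x"
    using eventually_nash_subset[of "\<lambda>x. h x = f x" V] by blast
  with * show "(V, h) \<in> germ f" by (auto simp: nash_of_fun_def nash_pairs_def)
qed

lemma germ_cong:
  assumes "eventually (\<lambda>x. f x = h x) F" shows "germ f = germ h"
proof -
  have "eventually (\<lambda>x. k x = f x) F \<longleftrightarrow> eventually (\<lambda>x. k x = h x) F" for k
  proof
    show "eventually (\<lambda>x. k x = h x) F" if "eventually (\<lambda>x. k x = f x) F"
      using that assms by eventually_elim simp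
    show "eventually (\<lambda>x. k x = f x) F" if "eventually (\<lambda>x. k x = h x) F"
      using that assms by eventually_elim simp
  qed
  then show ?thesis by (auto simp: mem_germ set_eq_iff)
qed

lemma germ_eq_iff:
  assumes "is_nash f" shows "germ f = germ h \<longleftrightarrow> eventually (\<lambda>x. f x = h x) F"
proof
  assume eq: "germ f = germ h"
  from assms obtain U where "U \<in> \<Omega>" "f \<in> nash_functions U" by (auto simp: is_nash_def)
  then have "(U, f) \<in> germ f" by (simp add: mem_germ)
  then show "eventually (\<lambda>x. f x = h x) F" by (simp add: eq mem_germ)
qed (rule germ_cong)

text \<open>The equivalence class of \<open>(U, f)\<close> is the germ of the total function
  \<open>f\<close>, whatever the domain \<open>U\<close>; elements of the field can henceforth be
  written without domains.\<close>

lemma carrier_iff: "A \<in> carrier K \<longleftrightarrow> (\<exists>f. is_nash f \<and> A = germ f)"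
proof -
  have cls: "nash_rel \<Omega> `` {(U, f)} = germ f" if "(U, f) \<in> nash_pairs \<Omega>" for U f
  proof -
    have U: "U \<in> \<Omega>" "f \<in> nash_functions U" using that by (auto simp: nash_pairs_def)
    have "((U, f), (V, h)) \<in> nash_rel \<Omega> \<longleftrightarrow> (V, h) \<in> germ f" for V h
    proof
      assume "((U, f), (V, h)) \<in> nash_rel \<Omega>"
      then obtain W where "(V, h) \<in> nash_pairs \<Omega>" "W \<in> \<Omega>" "W \<subseteq> U \<inter> V" "\<forall>x\<in>W. f x = h x"
        by (auto simp: nash_rel_def)
      then show "(V, h) \<in> germ f"
        unfolding nash_of_fun_def by (auto intro!: bexI[of _ W])
    next
      assume h: "(V, h) \<in> germ f"
      then have V: "V \<in> \<Omega>" "h \<in> nash_functions V" "eventually (\<lambda>x. h x = f x) F"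
        by (auto simp: mem_germ)
      obtain W where W: "W \<in> \<Omega>" "W \<subseteq> V" "\<And>x. x \<in> W \<Longrightarrow> h x = f x"
        using eventually_nash_subset[OF V(3,1)] by blast
      obtain W' where "W' \<in> \<Omega>" "W' \<subseteq> W \<inter> U" using \<Omega>_directed[OF W(1) U(1)] by blast
      then have "\<exists>W\<in>\<Omega>. W \<subseteq> U \<inter> V \<and> (\<forall>x\<in>W. f x = h x)"
        using W by (intro bexI[of _ W']) auto
      with V U show "((U, f), (V, h)) \<in> nash_rel \<Omega>"
        by (simp add: nash_rel_def nash_pairs_def)
    qed
    then show ?thesis by (auto simp: Image_def)
  qed
  have "carrier K = nash_pairs \<Omega> // nash_rel \<Omega>" by (simp add: nash_field_def)
  then have "A \<in> carrier K \<longleftrightarrow> (\<exists>p\<in>nash_pairs \<Omega>. A = nash_rel \<Omega> `` {p})"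
    by (simp add: quotient_def)
  also have "\<dots> \<longleftrightarrow> (\<exists>(U, f)\<in>nash_pairs \<Omega>. A = germ f)"
  proof (intro bex_cong refl)
    fix p assume p: "p \<in> nash_pairs \<Omega>"
    obtain U f where "p = (U, f)" by (rule prod.exhaust)
    with p cls show "A = nash_rel \<Omega> `` {p} \<longleftrightarrow> (case p of (U, f) \<Rightarrow> A = germ f)" by simp
  qed
  also have "\<dots> \<longleftrightarrow> (\<exists>f. is_nash f \<and> A = germ f)"
    by (auto simp: nash_pairs_def is_nash_def)
  finally show ?thesis .
qed

lemma carrierE:
  assumes "A \<in> carrier K" obtains f where "is_nash f" "A = germ f"
  using assms carrier_iff by auto

lemma germ_carrier: "is_nash f \<Longrightarrow> germ f \<in> carrier K"
  using carrier_iff by blast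

text \<open>Both sides consist of the Nash pairs that eventually agree with the pointwise result, so
  \<open>oper\<close> may be arbitrary; if the result is not a Nash function, both sets are
  empty.\<close>

lemma lift2_germ:
  assumes "is_nash f" "is_nash h"
  shows "nash_lift2 \<Omega> oper (germ f) (germ h) = germ (\<lambda>x. oper (f x) (h x))"
proof -
  have "(V, k) \<in> nash_lift2 \<Omega> oper (germ f) (germ h) \<longleftrightarrow> (V, k) \<in> germ (\<lambda>x. oper (f x) (h x))" for V k
  proof
    assume "(V, k) \<in> nash_lift2 \<Omega> oper (germ f) (germ h)"
    then obtain U1 f1 U2 f2 W where *: "V \<in> \<Omega>" "k \<in> nash_functions V" "(U1, f1) \<in> germ f"
      "(U2, f2) \<in> germ h" "W \<in> \<Omega>" "\<forall>x\<in>W. k x = oper (f1 x) (f2 x)"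
      by (auto simp: nash_lift2_def nash_pairs_def)
    then have "eventually (\<lambda>x. k x = oper (f1 x) (f2 x)) F" "eventually (\<lambda>x. f1 x = f x) F"
      "eventually (\<lambda>x. f2 x = h x) F" by (auto simp: mem_germ eventually_nash)
    then have "eventually (\<lambda>x. k x = oper (f x) (h x)) F" by eventually_elim simp
    with * show "(V, k) \<in> germ (\<lambda>x. oper (f x) (h x))" by (simp add: mem_germ)
  next
    assume "(V, k) \<in> germ (\<lambda>x. oper (f x) (h x))"
    then have k: "V \<in> \<Omega>" "k \<in> nash_functions V" "eventually (\<lambda>x. k x = oper (f x) (h x)) F"
      by (auto simp: mem_germ)
    from assms obtain U1 U2 where U: "U1 \<in> \<Omega>" "f \<in> nash_functions U1" "U2 \<in> \<Omega>" "h \<in> nash_functions U2"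
      by (auto simp: is_nash_def)
    then have fh: "(U1, f) \<in> germ f" "(U2, h) \<in> germ h" by (simp_all add: mem_germ)
    obtain W where W: "W \<in> \<Omega>" "W \<subseteq> V" "\<And>x. x \<in> W \<Longrightarrow> k x = oper (f x) (h x)"
      using eventually_nash_subset[OF k(3,1)] by blast
    obtain W1 where W1: "W1 \<in> \<Omega>" "W1 \<subseteq> W \<inter> U1" using \<Omega>_directed[OF W(1) U(1)] by blast
    obtain W2 where W2: "W2 \<in> \<Omega>" "W2 \<subseteq> W1 \<inter> U2" using \<Omega>_directed[OF W1(1) U(3)] by blast
    have "W2 \<subseteq> V \<inter> U1 \<inter> U2" "\<forall>x\<in>W2. k x = oper (f x) (h x)" using W W1 W2 by auto
    with W2(1) have "\<exists>W\<in>\<Omega>. W \<subseteq> V \<inter> U1 \<inter> U2 \<and> (\<forall>x\<in>W. k x = oper (f x) (h x))" by blast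
    then have "\<exists>(U1, f1)\<in>germ f. \<exists>(U2, f2)\<in>germ h. \<exists>W\<in>\<Omega>.
        W \<subseteq> V \<inter> U1 \<inter> U2 \<and> (\<forall>x\<in>W. k x = oper (f1 x) (f2 x))"
      by (intro bexI[OF _ fh(1)] case_prodI bexI[OF _ fh(2)])
    with k(1,2) show "(V, k) \<in> nash_lift2 \<Omega> oper (germ f) (germ h)"
      by (simp add: nash_lift2_def nash_pairs_def)
  qed
  then show ?thesis by (simp add: set_eq_iff split_paired_all)
qed

lemma K_simps:
  assumes "is_nash f" "is_nash h"
  shows "germ f \<oplus>\<^bsub>K\<^esub> germ h = germ (\<lambda>x. f x + h x)"
    and "germ f \<otimes>\<^bsub>K\<^esub> germ h = germ (\<lambda>x. f x * h x)"
  using lift2_germ[OF assms] by (simp_all add: nash_field_def)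

lemma K_zero: "\<zero>\<^bsub>K\<^esub> = germ (\<lambda>x. 0)" and K_one: "\<one>\<^bsub>K\<^esub> = germ (\<lambda>x. 1)"
  by (simp_all add: nash_field_def)

lemma germ_eq_zero_iff: "is_nash f \<Longrightarrow> germ f = \<zero>\<^bsub>K\<^esub> \<longleftrightarrow> eventually (\<lambda>x. f x = 0) F"
  by (simp add: K_zero germ_eq_iff)

lemma field_K: "field K"
proof -
  have ag: "abelian_group K"
  proof (rule abelian_groupI)
    fix A B C assume A: "A \<in> carrier K" and B: "B \<in> carrier K" and C: "C \<in> carrier K"
    obtain f where f: "is_nash f" "A = germ f" using A by (rule carrierE)
    obtain g where g: "is_nash g" "B = germ g" using B by (rule carrierE)
    obtain h where h: "is_nash h" "C = germ h" using C by (rule carrierE)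
    note fgh = f g h
    show "A \<oplus>\<^bsub>K\<^esub> B \<in> carrier K"
      using fgh by (simp add: K_simps germ_carrier is_nash_add)
    show "A \<oplus>\<^bsub>K\<^esub> B = B \<oplus>\<^bsub>K\<^esub> A"
      using fgh by (simp add: K_simps add.commute)
    show "A \<oplus>\<^bsub>K\<^esub> B \<oplus>\<^bsub>K\<^esub> C = A \<oplus>\<^bsub>K\<^esub> (B \<oplus>\<^bsub>K\<^esub> C)"
      using fgh by (simp add: K_simps is_nash_add add.assoc)
    show "\<zero>\<^bsub>K\<^esub> \<oplus>\<^bsub>K\<^esub> A = A"
      using fgh by (simp add: K_zero K_simps)
    show "\<exists>B\<in>carrier K. B \<oplus>\<^bsub>K\<^esub> A = \<zero>\<^bsub>K\<^esub>"
      by (rule bexI[of _ "germ (\<lambda>x. - f x)"])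
        (use fgh in \<open>simp_all add: K_zero K_simps is_nash_uminus germ_carrier\<close>)
  qed (simp add: K_zero germ_carrier)
  have cm: "comm_monoid K"
  proof (rule comm_monoidI)
    fix A B C assume A: "A \<in> carrier K" and B: "B \<in> carrier K" and C: "C \<in> carrier K"
    obtain f where f: "is_nash f" "A = germ f" using A by (rule carrierE)
    obtain g where g: "is_nash g" "B = germ g" using B by (rule carrierE)
    obtain h where h: "is_nash h" "C = germ h" using C by (rule carrierE)
    note fgh = f g h
    show "A \<otimes>\<^bsub>K\<^esub> B \<in> carrier K"
      using fgh by (simp add: K_simps germ_carrier is_nash_mult)
    show "A \<otimes>\<^bsub>K\<^esub> B = B \<otimes>\<^bsub>K\<^esub> A"
      using fgh by (simp add: K_simps mult.commute)
    show "A \<otimes>\<^bsub>K\<^esub> B \<otimes>\<^bsub>K\<^esub> C = A \<otimes>\<^bsub>K\<^esub> (B \<otimes>\<^bsub>K\<^esub> C)"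
      using fgh by (simp add: K_simps is_nash_mult mult.assoc)
    show "\<one>\<^bsub>K\<^esub> \<otimes>\<^bsub>K\<^esub> A = A"
      using fgh by (simp add: K_one K_simps)
  qed (simp add: K_one germ_carrier)
  have "cring K"
  proof (rule cringI[OF ag cm])
    fix A B C assume A: "A \<in> carrier K" and B: "B \<in> carrier K" and C: "C \<in> carrier K"
    obtain f where f: "is_nash f" "A = germ f" using A by (rule carrierE)
    obtain g where g: "is_nash g" "B = germ g" using B by (rule carrierE)
    obtain h where h: "is_nash h" "C = germ h" using C by (rule carrierE)
    note fgh = f g h
    show "(A \<oplus>\<^bsub>K\<^esub> B) \<otimes>\<^bsub>K\<^esub> C = A \<otimes>\<^bsub>K\<^esub> C \<oplus>\<^bsub>K\<^esub> B \<otimes>\<^bsub>K\<^esub> C"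
      using fgh by (simp add: K_simps is_nash_mult is_nash_add algebra_simps)
  qed
  then show ?thesis
  proof (rule cring.cring_fieldI2)
    show "\<zero>\<^bsub>K\<^esub> \<noteq> \<one>\<^bsub>K\<^esub>"
      using not_bot by (simp add: K_zero K_one germ_eq_iff eventually_False)
    fix A assume "A \<in> carrier K" "A \<noteq> \<zero>\<^bsub>K\<^esub>"
    from this(1) obtain f where f: "is_nash f" "A = germ f" by (rule carrierE)
    with \<open>A \<noteq> \<zero>\<^bsub>K\<^esub>\<close> have "\<not> eventually (\<lambda>x. f x = 0) F" by (simp add: germ_eq_zero_iff)
    \<comment> \<open>A nonzero germ is only known not to vanish identically on any member; the
      dichotomy improves this to having no zeros on some member.\<close>
    then have "eventually (\<lambda>x. f x \<noteq> 0) F" using is_nash_dichotomy[OF f(1)] by blast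
    then have "eventually (\<lambda>x. f x * inverse (f x) = 1) F" by eventually_elim simp
    from germ_cong[OF this] have "A \<otimes>\<^bsub>K\<^esub> germ (\<lambda>x. inverse (f x)) = \<one>\<^bsub>K\<^esub>"
      by (simp add: f(2) K_simps(2)[OF f(1) is_nash_inverse[OF f(1)]] K_one)
    then show "\<exists>B\<in>carrier K. A \<otimes>\<^bsub>K\<^esub> B = \<one>\<^bsub>K\<^esub>"
      using germ_carrier[OF is_nash_inverse[OF f(1)]] by (rule bexI)
  qed
qed

sublocale K: field K
  by (rule field_K)

lemma germ_pow: "is_nash f \<Longrightarrow> germ f [^]\<^bsub>K\<^esub> (n :: nat) = germ (\<lambda>x. f x ^ n)"
  by (induction n) (simp_all add: K_one K_simps is_nash_power mult.commute)

lemma germ_add_pow: "[n] \<cdot>\<^bsub>K\<^esub> \<one>\<^bsub>K\<^esub> = germ (\<lambda>x. of_nat n)"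
  by (induction n) (simp_all add: K_one K_zero K_simps add.commute)

lemma germ_sum:
  assumes "\<And>i. i \<in> S \<Longrightarrow> is_nash (f i)" "finite S"
  shows "(\<Oplus>\<^bsub>K\<^esub>i\<in>S. germ (f i)) = germ (\<lambda>x. \<Sum>i\<in>S. f i x)"
  using assms(2,1)
proof (induction S)
  case empty
  then show ?case by (simp add: K_zero)
next
  case (insert i S)
  then have "(\<Oplus>\<^bsub>K\<^esub>i\<in>insert i S. germ (f i)) = germ (f i) \<oplus>\<^bsub>K\<^esub> (\<Oplus>\<^bsub>K\<^esub>i\<in>S. germ (f i))"
    by (intro K.finsum_insert) (auto simp: germ_carrier)
  with insert show ?case by (simp add: K_simps is_nash_sum)
qed

lemma germ_prod:
  assumes "\<And>i. i \<in> S \<Longrightarrow> is_nash (f i)" "finite S"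
  shows "(\<Otimes>\<^bsub>K\<^esub>i\<in>S. germ (f i)) = germ (\<lambda>x. \<Prod>i\<in>S. f i x)"
  using assms(2,1)
proof (induction S)
  case empty
  then show ?case by (simp add: K_one)
next
  case (insert i S)
  then have "(\<Otimes>\<^bsub>K\<^esub>i\<in>insert i S. germ (f i)) = germ (f i) \<otimes>\<^bsub>K\<^esub> (\<Otimes>\<^bsub>K\<^esub>i\<in>S. germ (f i))"
    by (intro K.finprod_insert) (auto simp: germ_carrier)
  with insert show ?case by (simp add: K_simps is_nash_prod)
qed

end


section \<open>Derivations on the field of Nash functions\<close>

context nash
begin

lemma eventually_has_dpart:
  assumes "is_nash f" shows "eventually (\<lambda>x. has_dpart t f (dpart t f x) x) F"
proof -
  from assms obtain U where "U \<in> \<Omega>" "holomorphic_fun f U" by (auto simp: is_nash_iff)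
  then show ?thesis
    unfolding eventually_nash
    by (intro bexI[of _ U] ballI holomorphic_fun_has_dpart[of f U]) (simp_all add: \<Omega>_open)
qed

text \<open>Members of \<Omega> are open, so an eventual identity may be differentiated.\<close>

lemma eventually_dpart_cong:
  assumes "eventually (\<lambda>x. f x = h x) F"
  shows "eventually (\<lambda>x. dpart t f x = dpart t h x) F"
    and "eventually (\<lambda>x. \<forall>d. has_dpart t f d x \<longleftrightarrow> has_dpart t h d x) F"
proof -
  from assms obtain U where U: "U \<in> \<Omega>" "\<And>x. x \<in> U \<Longrightarrow> f x = h x" by (auto simp: eventually_nash)
  show "eventually (\<lambda>x. dpart t f x = dpart t h x) F"
    unfolding eventually_nash
    by (intro bexI[OF _ U(1)] ballI has_dpart_cong(2)[OF \<Omega>_open[OF U(1)] _ U(2)])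
  show "eventually (\<lambda>x. \<forall>d. has_dpart t f d x \<longleftrightarrow> has_dpart t h d x) F"
    unfolding eventually_nash
    by (intro bexI[OF _ U(1)] ballI allI has_dpart_cong(1)[OF \<Omega>_open[OF U(1)] _ U(2)])
qed

text \<open>Implicit differentiation of an annihilating polynomial of least degree: its derivative
  \<open>s\<close> in the last variable does not vanish at \<open>f\<close>. In particular no Hartogs-type argument is
  needed to see that partial derivatives of Nash functions are Nash functions.\<close>

lemma dpart_formula:
  assumes f: "is_nash f"
  shows "\<exists>m a s. (\<forall>i. a i \<in> polyfuns) \<and> is_nash s \<and>
    (\<forall>t a'. (\<forall>i x. has_dpart t (a i) (a' i x) x) \<longrightarrow>
       eventually (\<lambda>x. dpart t f x = - (\<Sum>i\<le>m. a' i x * f x ^ i) * inverse (s x)) F)"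
proof -
  from f have "\<exists>m a. annihilates F m a f" by (simp add: is_nash_iff alg_def)
  then obtain m where "\<exists>a. annihilates F m a f" and least: "\<And>k b. k < m \<Longrightarrow> \<not> annihilates F k b f"
    unfolding exists_least_iff[of "\<lambda>m. \<exists>a. annihilates F m a f"] by blast
  then obtain a where ann: "annihilates F m a f" by blast
  from annihilates_pos[OF ann] obtain m' where m: "m = Suc m'" by (auto simp: gr0_conv_Suc)
  have a: "a i \<in> polyfuns" for i using ann by (simp add: annihilates_def)
  \<comment> \<open>The derivative of the annihilator in its last variable, taken at
    \<open>f\<close>; the index is shifted, the coefficient of \<open>f ^ i\<close> coming from
    degree \<open>Suc i\<close>.\<close>
  define s where "s = (\<lambda>x. \<Sum>i\<le>m'. (of_nat (Suc i) * a (Suc i) x) * f x ^ i)"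
  have ca: "(\<lambda>x. of_nat (Suc i) * a (Suc i) x) \<in> polyfuns" for i
    using polyfuns_mult[OF polyfuns_consts(3) a] .
  have s: "is_nash s"
    unfolding s_def by (intro is_nash_sum is_nash_mult[OF is_nash_polyfun[OF ca]] is_nash_power f)
  \<comment> \<open>Otherwise \<open>s\<close> would give an annihilator of smaller degree
    \<open>m'\<close>, whose leading coefficient is nonzero because the characteristic is
    zero.\<close>
  have "\<not> eventually (\<lambda>x. s x = 0) F"
  proof
    assume "eventually (\<lambda>x. s x = 0) F"
    moreover have "\<exists>x. of_nat (Suc m') * a (Suc m') x \<noteq> 0"
      using ann by (auto simp: annihilates_def m simp del: of_nat_Suc)
    ultimately have "annihilates F m' (\<lambda>i x. of_nat (Suc i) * a (Suc i) x) f"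
      using ca by (simp add: annihilates_def s_def del: of_nat_Suc)
    with least[of m'] show False by (simp add: m)
  qed
  with is_nash_dichotomy[OF s] have nz: "eventually (\<lambda>x. s x \<noteq> 0) F" by blast
  show ?thesis
  proof (intro exI conjI allI impI)
    fix t a' assume a': "\<forall>i x. has_dpart t (a i) (a' i x) x"
    have "eventually (\<lambda>x. (\<Sum>i\<le>m. a i x * f x ^ i) = 0) F"
      using ann by (simp add: annihilates_def)
    from eventually_dpart_cong(2)[OF this, of t] eventually_has_dpart[OF f, of t] nz
    show "eventually (\<lambda>x. dpart t f x = - (\<Sum>i\<le>m. a' i x * f x ^ i) * inverse (s x)) F"
    proof eventually_elim
      case (elim x)
      have "has_dpart t (\<lambda>x. \<Sum>i\<le>m. a i x * f x ^ i)
          (\<Sum>i\<le>m. a' i x * f x ^ i + a i x * (of_nat i * f x ^ (i - 1) * dpart t f x)) x"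
        by (intro has_dpart_sum has_dpart_mult has_dpart_power a'[rule_format] elim(2))
      then have "has_dpart t (\<lambda>x. 0)
          (\<Sum>i\<le>m. a' i x * f x ^ i + a i x * (of_nat i * f x ^ (i - 1) * dpart t f x)) x"
        using elim(1) by blast
      from has_dpart_unique[OF this has_dpart_const]
      have "(\<Sum>i\<le>m. a' i x * f x ^ i) + (\<Sum>i\<le>m. a i x * of_nat i * f x ^ (i - 1)) * dpart t f x = 0"
        by (simp add: sum.distrib sum_distrib_right mult.assoc)
      also have "(\<Sum>i\<le>m. a i x * of_nat i * f x ^ (i - 1)) = s x"
        unfolding m s_def by (subst sum.atMost_Suc_shift) (simp add: mult_ac)
      finally have "(\<Sum>i\<le>m. a' i x * f x ^ i) = - (s x * dpart t f x)"
        by (simp add: eq_neg_iff_add_eq_0)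
      with elim(3) show ?case by (simp add: field_simps)
    qed
  qed (use a s in auto)
qed

text \<open>The coefficients of the annihilator have polynomial derivatives, so the implicit formula
  is built from Nash functions; holomorphy of the derivative is inherited from it.\<close>

lemma is_nash_dpart:
  assumes f: "is_nash f" shows "is_nash (dpart t f)"
proof -
  obtain m a s where a: "\<forall>i. a i \<in> polyfuns" and s: "is_nash s"
    and form: "\<forall>t a'. (\<forall>i x. has_dpart t (a i) (a' i x) x) \<longrightarrow>
       eventually (\<lambda>x. dpart t f x = - (\<Sum>i\<le>m. a' i x * f x ^ i) * inverse (s x)) F"
    using dpart_formula[OF f] by (elim exE conjE) (rule that)
  have "\<forall>i. \<exists>p'. p' \<in> polyfuns \<and> (\<forall>x. has_dpart t (a i) (p' x) x)"
    using polyfuns_has_dpart[OF a[rule_format], of t] by (simp add: Bex_def)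
  from choice[OF this] obtain a' where "\<forall>i. a' i \<in> polyfuns \<and> (\<forall>x. has_dpart t (a i) (a' i x) x)" ..
  then have a': "\<And>i. a' i \<in> polyfuns" "\<forall>i x. has_dpart t (a i) (a' i x) x" by simp_all
  have "is_nash (\<lambda>x. - (\<Sum>i\<le>m. a' i x * f x ^ i) * inverse (s x))"
    by (intro is_nash_mult[OF is_nash_uminus[OF is_nash_sum] is_nash_inverse[OF s]]
        is_nash_mult[OF is_nash_polyfun[OF a'(1)] is_nash_power[OF f]])
  moreover have "eventually (\<lambda>x. - (\<Sum>i\<le>m. a' i x * f x ^ i) * inverse (s x) = dpart t f x) F"
    using form[rule_format, OF a'(2)[rule_format]] by eventually_elim simp
  ultimately show ?thesis by (rule is_nash_cong)
qed

text \<open>The data \<open>m\<close>, \<open>a\<close>, \<open>s\<close> of the implicit formula do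
  not depend on \<open>t\<close>: a variable that occurs in none of the coefficients up to
  \<open>m\<close> has zero partial derivative.\<close>

lemma finite_dpart_support:
  assumes f: "is_nash f" shows "finite {t. \<not> eventually (\<lambda>x. dpart t f x = 0) F}"
proof -
  obtain m a s where a: "\<forall>i. a i \<in> polyfuns" and s: "is_nash s"
    and form: "\<forall>t a'. (\<forall>i x. has_dpart t (a i) (a' i x) x) \<longrightarrow>
       eventually (\<lambda>x. dpart t f x = - (\<Sum>i\<le>m. a' i x * f x ^ i) * inverse (s x)) F"
    using dpart_formula[OF f] by (elim exE conjE) (rule that)
  have "\<forall>i. \<exists>V. finite V \<and> (\<forall>t. t \<notin> V \<longrightarrow> (\<forall>x z. a i (x(t := z)) = a i x))"
    by (intro allI polyfuns_finite_support a[rule_format])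
  from choice[OF this] obtain V
    where "\<forall>i. finite (V i) \<and> (\<forall>t. t \<notin> V i \<longrightarrow> (\<forall>x z. a i (x(t := z)) = a i x))" ..
  then have V: "\<And>i. finite (V i)" "\<And>i t x z. t \<notin> V i \<Longrightarrow> a i (x(t := z)) = a i x"
    by (simp_all del: fun_upd_apply)
  have "eventually (\<lambda>x. dpart t f x = 0) F" if t: "t \<notin> (\<Union>i\<le>m. V i)" for t
  proof -
    \<comment> \<open>The formula asks for derivatives of all coefficients. Those up to
      \<open>m\<close> are zero because \<open>t\<close> does not occur in them; those beyond
      \<open>m\<close> may be anything.\<close>
    have "\<forall>i. \<exists>p'. (\<forall>x. has_dpart t (a i) (p' x) x) \<and> (i \<le> m \<longrightarrow> (\<forall>x. p' x = 0))"
    proof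
      fix i
      show "\<exists>p'. (\<forall>x. has_dpart t (a i) (p' x) x) \<and> (i \<le> m \<longrightarrow> (\<forall>x. p' x = 0))"
      proof (cases "i \<le> m")
        case True
        then have "has_dpart t (a i) 0 x" for x
          using t V(2)[of t i] unfolding has_dpart_def by simp
        then show ?thesis by (intro exI[of _ "\<lambda>x. 0"]) simp
      next
        case False
        then show ?thesis using polyfuns_has_dpart[OF a[rule_format, of i], of t] by auto
      qed
    qed
    from choice[OF this] obtain a'
      where "\<forall>i. (\<forall>x. has_dpart t (a i) (a' i x) x) \<and> (i \<le> m \<longrightarrow> (\<forall>x. a' i x = 0))" ..
    then have a': "\<And>i x. has_dpart t (a i) (a' i x) x" "\<And>i x. i \<le> m \<Longrightarrow> a' i x = 0" by simp_all
    from form[rule_format, OF a'(1)] show ?thesis by eventually_elim (simp add: a'(2))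
  qed
  then have "{t. \<not> eventually (\<lambda>x. dpart t f x = 0) F} \<subseteq> (\<Union>i\<le>m. V i)" by blast
  then show ?thesis by (rule finite_subset) (use V(1) in blast)
qed

text \<open>Partial differentiation is local, so neither the representative nor its domain
  matters.\<close>

lemma partial_germ:
  assumes f: "is_nash f" shows "nash_partial \<Omega> t (germ f) = germ (dpart t f)"
proof -
  have "(V, h) \<in> nash_partial \<Omega> t (germ f) \<longleftrightarrow> (V, h) \<in> germ (dpart t f)" for V h
  proof
    assume "(V, h) \<in> nash_partial \<Omega> t (germ f)"
    then obtain U f' W where *: "V \<in> \<Omega>" "h \<in> nash_functions V" "(U, f') \<in> germ f"
      "W \<in> \<Omega>" "\<forall>x\<in>W. h x = dpart t f' x"
      by (auto simp: nash_partial_def nash_pairs_def dpart_def)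
    then have "eventually (\<lambda>x. h x = dpart t f' x) F" "eventually (\<lambda>x. f' x = f x) F"
      by (auto simp: mem_germ eventually_nash)
    from this(1) eventually_dpart_cong(1)[OF this(2), of t]
    have "eventually (\<lambda>x. h x = dpart t f x) F" by eventually_elim simp
    with * show "(V, h) \<in> germ (dpart t f)" by (simp add: mem_germ)
  next
    assume "(V, h) \<in> germ (dpart t f)"
    then have h: "V \<in> \<Omega>" "h \<in> nash_functions V" "eventually (\<lambda>x. h x = dpart t f x) F"
      by (auto simp: mem_germ)
    from f obtain U where U: "U \<in> \<Omega>" "f \<in> nash_functions U" by (auto simp: is_nash_def)
    then have Uf: "(U, f) \<in> germ f" by (simp add: mem_germ)
    obtain W where W: "W \<in> \<Omega>" "W \<subseteq> V" "\<And>x. x \<in> W \<Longrightarrow> h x = dpart t f x"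
      using eventually_nash_subset[OF h(3,1)] by blast
    obtain W' where "W' \<in> \<Omega>" "W' \<subseteq> W \<inter> U" using \<Omega>_directed[OF W(1) U(1)] by blast
    then have "\<exists>W\<in>\<Omega>. W \<subseteq> V \<inter> U \<and> (\<forall>x\<in>W. h x = dpart t f x)"
      using W by (intro bexI[of _ W']) auto
    then have "\<exists>(U, f)\<in>germ f. \<exists>W\<in>\<Omega>. W \<subseteq> V \<inter> U \<and> (\<forall>x\<in>W. h x = dpart t f x)"
      by (intro bexI[OF _ Uf] case_prodI)
    with h show "(V, h) \<in> nash_partial \<Omega> t (germ f)"
      by (simp add: nash_partial_def nash_pairs_def dpart_def)
  qed
  then show ?thesis by (simp add: set_eq_iff split_paired_all)
qed

text \<open>Any finite superset \<open>S\<close> of the support may serve as index set, which lets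
  several functions share one sum.\<close>

lemma delta_germ:
  assumes f: "is_nash f" and G: "\<And>t. is_nash (G t)" "\<And>t. g t = germ (G t)"
    and S: "finite S" "{t. \<not> eventually (\<lambda>x. dpart t f x = 0) F} \<subseteq> S"
  shows "nash_delta \<Omega> g (germ f) = germ (\<lambda>x. \<Sum>t\<in>S. G t x * dpart t f x)"
proof -
  have nash: "is_nash (\<lambda>x. G t x * dpart t f x)" for t
    by (rule is_nash_mult[OF G(1) is_nash_dpart[OF f]])
  have trm: "g t \<otimes>\<^bsub>K\<^esub> nash_partial \<Omega> t (germ f) = germ (\<lambda>x. G t x * dpart t f x)" for t
    by (simp only: partial_germ[OF f] G(2) K_simps(2)[OF G(1) is_nash_dpart[OF f]])
  \<comment> \<open>\<open>A\<close> is the index set in the definition of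
    \<open>nash_delta\<close>; it may be smaller than the support of the partial derivatives, since
    some \<open>g t\<close> can be zero.\<close>
  define A where "A = {t. germ (\<lambda>x. G t x * dpart t f x) \<noteq> \<zero>\<^bsub>K\<^esub>}"
  have zero: "eventually (\<lambda>x. G t x * dpart t f x = 0) F" if "t \<notin> A" for t
    using that germ_eq_zero_iff[OF nash] by (simp add: A_def)
  have "A \<subseteq> S"
  proof
    fix t assume t: "t \<in> A"
    show "t \<in> S"
    proof (rule ccontr)
      assume "t \<notin> S"
      with S(2) have "eventually (\<lambda>x. dpart t f x = 0) F" by blast
      then have "eventually (\<lambda>x. G t x * dpart t f x = 0) F" by eventually_elim simp
      with t germ_eq_zero_iff[OF nash] show False by (simp add: A_def)
    qed
  qed
  then have finA: "finite A" using S(1) by (rule finite_subset)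
  have "nash_delta \<Omega> g (germ f) = (\<Oplus>\<^bsub>K\<^esub>t\<in>A. germ (\<lambda>x. G t x * dpart t f x))"
    by (simp add: nash_delta_def Let_def trm A_def)
  also have "\<dots> = germ (\<lambda>x. \<Sum>t\<in>A. G t x * dpart t f x)"
    by (rule germ_sum[OF nash finA])
  also have "\<dots> = germ (\<lambda>x. \<Sum>t\<in>S. G t x * dpart t f x)"
  proof (rule germ_cong)
    have "eventually (\<lambda>x. \<forall>t\<in>S - A. G t x * dpart t f x = 0) F"
      using S(1) zero by (intro eventually_ball_finite) auto
    then show "eventually (\<lambda>x. (\<Sum>t\<in>A. G t x * dpart t f x) = (\<Sum>t\<in>S. G t x * dpart t f x)) F"
    proof eventually_elim
      case (elim x)
      with S(1) \<open>A \<subseteq> S\<close> show ?case by (intro sum.mono_neutral_left) auto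
    qed
  qed
  finally show ?thesis .
qed

lemma delta_derivation:
  assumes g: "\<And>t. g t \<in> carrier K"
  shows "derivation K (nash_delta \<Omega> g)"
proof -
  from g carrier_iff have "\<forall>t. \<exists>f. is_nash f \<and> g t = germ f" by blast
  from choice[OF this] obtain G where G: "\<And>t. is_nash (G t)" "\<And>t. g t = germ (G t)" by blast
  have nash: "is_nash (\<lambda>x. \<Sum>t\<in>S. G t x * dpart t f x)" if "is_nash f" for f S
    by (rule is_nash_sum[OF is_nash_mult[OF G(1) is_nash_dpart[OF that]]])
  define S where "S = (\<lambda>f. {t. \<not> eventually (\<lambda>x. dpart t f x = 0) F})"
  have finS: "finite (S f)" if "is_nash f" for f
    unfolding S_def by (rule finite_dpart_support[OF that])
  have delta: "nash_delta \<Omega> g (germ f) = germ (\<lambda>x. \<Sum>t\<in>R. G t x * dpart t f x)"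
    if "is_nash f" "finite R" "S f \<subseteq> R" for f R
    using delta_germ[OF that(1) G that(2)] that(3) by (simp add: S_def)
  have "nash_delta \<Omega> g A \<in> carrier K" if "A \<in> carrier K" for A
  proof -
    from that obtain f where f: "is_nash f" "A = germ f" by (rule carrierE)
    then show ?thesis
      using delta[OF f(1) finS[OF f(1)]] germ_carrier[OF nash[OF f(1)]] by simp
  qed
  moreover have "nash_delta \<Omega> g (A \<oplus>\<^bsub>K\<^esub> B) = nash_delta \<Omega> g A \<oplus>\<^bsub>K\<^esub> nash_delta \<Omega> g B \<and>
      nash_delta \<Omega> g (A \<otimes>\<^bsub>K\<^esub> B) =
        (nash_delta \<Omega> g A \<otimes>\<^bsub>K\<^esub> B) \<oplus>\<^bsub>K\<^esub> (A \<otimes>\<^bsub>K\<^esub> nash_delta \<Omega> g B)"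
    if A: "A \<in> carrier K" and B: "B \<in> carrier K" for A B
  proof -
    from A obtain f where f: "is_nash f" "A = germ f" by (rule carrierE)
    from B obtain h where h: "is_nash h" "B = germ h" by (rule carrierE)
    let ?add = "\<lambda>x. f x + h x" and ?mult = "\<lambda>x. f x * h x"
    have add: "is_nash ?add" and mult: "is_nash ?mult"
      using f(1) h(1) by (rule is_nash_add, rule is_nash_mult)
    \<comment> \<open>One index set for \<open>f\<close>, \<open>h\<close>, their sum and their
      product makes additivity and the product rule termwise.\<close>
    define R where "R = S f \<union> S h \<union> S ?add \<union> S ?mult"
    have R: "finite R" "S f \<subseteq> R" "S h \<subseteq> R" "S ?add \<subseteq> R" "S ?mult \<subseteq> R"
      using finS[OF f(1)] finS[OF h(1)] finS[OF add] finS[OF mult] by (auto simp: R_def)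
    note deltas = delta[OF f(1) R(1,2)] delta[OF h(1) R(1,3)] delta[OF add R(1,4)] delta[OF mult R(1,5)]
    have "eventually (\<lambda>x. \<forall>t\<in>R. has_dpart t f (dpart t f x) x) F"
      "eventually (\<lambda>x. \<forall>t\<in>R. has_dpart t h (dpart t h x) x) F"
      using R(1) eventually_has_dpart f(1) h(1) by (auto intro!: eventually_ball_finite)
    then have ev: "eventually (\<lambda>x. \<forall>t\<in>R. dpart t ?add x = dpart t f x + dpart t h x \<and>
        dpart t ?mult x = dpart t f x * h x + f x * dpart t h x) F"
      by eventually_elim (blast intro: has_dpart_imp has_dpart_add has_dpart_mult)
    let ?d = "\<lambda>f x. \<Sum>t\<in>R. G t x * dpart t f x"
    have "eventually (\<lambda>x. ?d ?add x = ?d f x + ?d h x) F"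
      using ev by eventually_elim (simp add: sum.distrib distrib_left)
    then have "nash_delta \<Omega> g (germ ?add) = nash_delta \<Omega> g (germ f) \<oplus>\<^bsub>K\<^esub> nash_delta \<Omega> g (germ h)"
      unfolding deltas K_simps(1)[OF nash[OF f(1)] nash[OF h(1)]] by (rule germ_cong)
    moreover have "eventually (\<lambda>x. ?d ?mult x = ?d f x * h x + f x * ?d h x) F"
      using ev by eventually_elim (simp add: sum.distrib sum_distrib_left sum_distrib_right algebra_simps)
    then have "nash_delta \<Omega> g (germ ?mult) =
        (nash_delta \<Omega> g (germ f) \<otimes>\<^bsub>K\<^esub> germ h) \<oplus>\<^bsub>K\<^esub> (germ f \<otimes>\<^bsub>K\<^esub> nash_delta \<Omega> g (germ h))"
      unfolding deltas K_simps(2)[OF nash[OF f(1)] h(1)] K_simps(2)[OF f(1) nash[OF h(1)]]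
        K_simps(1)[OF is_nash_mult[OF nash[OF f(1)] h(1)] is_nash_mult[OF f(1) nash[OF h(1)]]]
      by (rule germ_cong)
    ultimately show ?thesis
      by (simp add: f(2) h(2) K_simps[OF f(1) h(1)])
  qed
  ultimately show ?thesis unfolding derivation_def by blast
qed

lemma delta_differential_field:
  assumes "\<And>t. g t \<in> carrier K"
  shows "differential_field K (nash_delta \<Omega> g)"
  unfolding differential_field_def
proof (intro conjI allI impI field_K delta_derivation assms)
  fix n :: nat assume "n > 0"
  then show "[n] \<cdot>\<^bsub>K\<^esub> \<one>\<^bsub>K\<^esub> \<noteq> \<zero>\<^bsub>K\<^esub>"
    using not_bot by (simp add: germ_add_pow K_zero germ_eq_iff eventually_False)
qed

lemma delta_var:
  assumes g: "\<And>t. g t \<in> carrier K"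
  shows "nash_delta \<Omega> g (nash_var \<Omega> t) = g t"
proof -
  from g carrier_iff have "\<forall>t. \<exists>f. is_nash f \<and> g t = germ f" by blast
  from choice[OF this] obtain G where G: "\<And>t. is_nash (G t)" "\<And>t. g t = germ (G t)" by blast
  have d: "dpart s (\<lambda>x. x t) x = (if t = s then 1 else 0)" for s x
    by (rule has_dpart_imp[OF has_dpart_var])
  have "nash_delta \<Omega> g (germ (\<lambda>x. x t)) = germ (\<lambda>x. \<Sum>s\<in>{t}. G s x * dpart s (\<lambda>x. x t) x)"
    by (rule delta_germ[OF _ G]) (auto simp: d)
  then show ?thesis by (simp add: nash_var_def d G(2))
qed

end


section \<open>Polynomials over the field of Nash functions\<close>

context nash
begin

lemma npolys_carrier: "p \<in> npolys K \<Longrightarrow> p m \<in> carrier K"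
  using K.indexed_pset_in_carrier[of "carrier K" p UNIV] by (simp add: K.carrier_coeff_def)

lemma npolys_finite:
  assumes "p \<in> npolys K" shows "finite {m. p m \<noteq> \<zero>\<^bsub>K\<^esub>}"
  using assms
proof (induction rule: K.indexed_pset.induct)
  case (indexed_const k)
  have "{m. K.indexed_const k m \<noteq> \<zero>\<^bsub>K\<^esub>} \<subseteq> {{#}}" by (auto simp: K.indexed_const_def)
  then show ?case by (rule finite_subset) simp
next
  case (indexed_padd P Q)
  have "{m. K.indexed_padd P Q m \<noteq> \<zero>\<^bsub>K\<^esub>} \<subseteq> {m. P m \<noteq> \<zero>\<^bsub>K\<^esub>} \<union> {m. Q m \<noteq> \<zero>\<^bsub>K\<^esub>}"
  proof
    fix m assume "m \<in> {m. K.indexed_padd P Q m \<noteq> \<zero>\<^bsub>K\<^esub>}"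
    then have "P m \<oplus>\<^bsub>K\<^esub> Q m \<noteq> \<zero>\<^bsub>K\<^esub>" by (simp add: K.indexed_padd_def)
    then have "\<not> (P m = \<zero>\<^bsub>K\<^esub> \<and> Q m = \<zero>\<^bsub>K\<^esub>)" using K.l_zero[OF K.zero_closed] by metis
    then show "m \<in> {m. P m \<noteq> \<zero>\<^bsub>K\<^esub>} \<union> {m. Q m \<noteq> \<zero>\<^bsub>K\<^esub>}" by simp
  qed
  then show ?case by (rule finite_subset) (use indexed_padd.IH in simp)
next
  case (indexed_pmult P i)
  have "{m. K.indexed_pmult P i m \<noteq> \<zero>\<^bsub>K\<^esub>} \<subseteq> (\<lambda>m. add_mset i m) ` {m. P m \<noteq> \<zero>\<^bsub>K\<^esub>}"
  proof
    fix m assume m: "m \<in> {m. K.indexed_pmult P i m \<noteq> \<zero>\<^bsub>K\<^esub>}"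
    then have "i \<in># m" "P (m - {#i#}) \<noteq> \<zero>\<^bsub>K\<^esub>"
      by (auto simp: K.indexed_pmult_def split: if_splits)
    then show "m \<in> (\<lambda>m. add_mset i m) ` {m. P m \<noteq> \<zero>\<^bsub>K\<^esub>}"
      by (intro image_eqI[of _ _ "m - {#i#}"]) auto
  qed
  then show ?case by (rule finite_subset) (use indexed_pmult.IH in simp)
qed

lemma npolys_finite_vars:
  assumes "p \<in> npolys K" shows "finite {j. \<not> K.index_free p j}"
proof -
  have "{j. \<not> K.index_free p j} \<subseteq> (\<Union>m\<in>{m. p m \<noteq> \<zero>\<^bsub>K\<^esub>}. set_mset m)"
    by (auto simp: K.index_free_def)
  then show ?thesis by (rule finite_subset) (use npolys_finite[OF assms] in simp)
qed

lemma npoly_ord_ge: "- 1 \<le> npoly_ord K p"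
  by (simp add: npoly_ord_def)

lemma le_npoly_ord:
  assumes "p \<in> npolys K" "p m \<noteq> \<zero>\<^bsub>K\<^esub>" "j \<in># m" shows "int j \<le> npoly_ord K p"
proof -
  have j: "\<not> K.index_free p j" using assms(2,3) by (auto simp: K.index_free_def)
  then have "j \<le> Max {j. \<not> K.index_free p j}"
    using npolys_finite_vars[OF assms(1)] by (intro Max_ge) auto
  with j show ?thesis by (auto simp: npoly_ord_def)
qed

lemma npoly_zero: "npoly_zero K = (\<lambda>_. \<zero>\<^bsub>K\<^esub>)"
  by (rule K.indexed_zero_def)

text \<open>Passes from \<open>npoly_ord\<close>, where the zero polynomial has order -1 like the
  other constants, to \<open>npoly_alpha\<close>, where it has value minus infinity.\<close>

lemma A_pairsI:
  assumes p: "p \<in> npolys K" and q: "q \<in> npolys K"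
    and less: "npoly_ord K q < npoly_ord K p" and nz: "q \<noteq> npoly_zero K"
  shows "(p, q) \<in> A_pairs \<Omega>"
proof -
  \<comment> \<open>The order of \<open>q\<close> is at least -1, so that of \<open>p\<close> is at
    least 0, whereas the zero polynomial has order -1.\<close>
  have "p \<noteq> npoly_zero K"
  proof
    assume "p = npoly_zero K"
    then have "K.index_free p j" for j by (simp add: npoly_zero K.index_free_def)
    then have "npoly_ord K p = - 1" by (simp add: npoly_ord_def)
    with less npoly_ord_ge[of q] show False by simp
  qed
  moreover have "- 1 \<le> real_of_int (npoly_ord K q)" using npoly_ord_ge[of q] by linarith
  then have "ereal (- 1) \<le> ereal (real_of_int (npoly_ord K q))" by (simp only: ereal_less_eq)
  ultimately show ?thesis
    using p q less nz by (simp add: A_pairs_def npoly_alpha_def one_ereal_def)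
qed

text \<open>Iterated derivatives are controlled only up to the order of the polynomial, so agreement
  is asked only at the variables that occur.\<close>

lemma npoly_eval_cong:
  assumes p: "p \<in> npolys K" and y: "\<And>j. y' j \<in> carrier K"
    and eq: "\<And>m j. p m \<noteq> \<zero>\<^bsub>K\<^esub> \<Longrightarrow> j \<in># m \<Longrightarrow> y j = y' j"
  shows "npoly_eval K p y = npoly_eval K p y'"
  unfolding npoly_eval_def
proof (rule K.finsum_cong'[OF refl])
  show "(\<lambda>m. p m \<otimes>\<^bsub>K\<^esub> (\<Otimes>\<^bsub>K\<^esub>j\<in>set_mset m. y' j [^]\<^bsub>K\<^esub> count m j)) \<in> {m. p m \<noteq> \<zero>\<^bsub>K\<^esub>} \<rightarrow> carrier K"
    using y npolys_carrier[OF p] by (auto intro!: K.m_closed K.finprod_closed)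
  fix m assume "m \<in> {m. p m \<noteq> \<zero>\<^bsub>K\<^esub>}"
  then have "y j = y' j" if "j \<in># m" for j using eq that by simp
  then have "(\<Otimes>\<^bsub>K\<^esub>j\<in>set_mset m. y j [^]\<^bsub>K\<^esub> count m j) = (\<Otimes>\<^bsub>K\<^esub>j\<in>set_mset m. y' j [^]\<^bsub>K\<^esub> count m j)"
    using y by (intro K.finprod_cong'[OF refl]) auto
  then show "p m \<otimes>\<^bsub>K\<^esub> (\<Otimes>\<^bsub>K\<^esub>j\<in>set_mset m. y j [^]\<^bsub>K\<^esub> count m j) =
      p m \<otimes>\<^bsub>K\<^esub> (\<Otimes>\<^bsub>K\<^esub>j\<in>set_mset m. y' j [^]\<^bsub>K\<^esub> count m j)" by simp
qed

lemma nash_var_carrier: "nash_var \<Omega> t \<in> carrier K"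
  unfolding nash_var_def by (intro germ_carrier is_nash_const)

text \<open>Independence of monomials is applied on a single member \<open>U\<close> of \<Omega>:
  the relation and the vanishing derivatives of the coefficients are finitely many eventual
  conditions, hence hold together there.\<close>

lemma npoly_eval_vars_nonzero:
  assumes q: "q \<in> npolys K" and nz: "q \<noteq> npoly_zero K" and ord: "npoly_ord K q < int n"
    and inj: "inj_on s {..<n}" and D: "\<And>j. j < n \<Longrightarrow> s j \<in> D_set \<Omega> q"
  shows "npoly_eval K q (\<lambda>j. nash_var \<Omega> (s j)) \<noteq> \<zero>\<^bsub>K\<^esub>"
proof
  assume zero: "npoly_eval K q (\<lambda>j. nash_var \<Omega> (s j)) = \<zero>\<^bsub>K\<^esub>"
  define M where "M = {m. q m \<noteq> \<zero>\<^bsub>K\<^esub>}"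
  have M: "finite M" "M \<noteq> {}"
    using npolys_finite[OF q] nz by (auto simp: M_def npoly_zero)
  \<comment> \<open>Monomials of \<open>q\<close> use only variables below \<open>n\<close>, so the
    exponents at these determine them.\<close>
  have sub: "set_mset m \<subseteq> {..<n}" if "m \<in> M" for m
    using le_npoly_ord[OF q, of m] that ord by (fastforce simp: M_def)
  have "\<forall>m. \<exists>f. is_nash f \<and> q m = germ f" using npolys_carrier[OF q] by (simp flip: carrier_iff)
  from choice[OF this] obtain Q where "\<forall>m. is_nash (Q m) \<and> q m = germ (Q m)" ..
  then have Q: "\<And>m. is_nash (Q m)" "\<And>m. q m = germ (Q m)" by simp_all
  define P where "P = (\<lambda>m (x :: 't \<Rightarrow> complex). \<Prod>j\<in>set_mset m. x (s j) ^ count m j)"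
  have P: "is_nash (P m)" for m
    unfolding P_def by (intro is_nash_prod is_nash_power is_nash_const)
  have "(\<Otimes>\<^bsub>K\<^esub>j\<in>set_mset m. nash_var \<Omega> (s j) [^]\<^bsub>K\<^esub> count m j) = germ (P m)" for m
    unfolding P_def nash_var_def germ_pow[OF is_nash_const(5)]
    by (rule germ_prod) (simp_all add: is_nash_power)
  then have "npoly_eval K q (\<lambda>j. nash_var \<Omega> (s j)) = (\<Oplus>\<^bsub>K\<^esub>m\<in>M. germ (\<lambda>x. Q m x * P m x))"
    unfolding npoly_eval_def M_def by (simp only: Q(2) K_simps(2)[OF Q(1) P])
  also have "\<dots> = germ (\<lambda>x. \<Sum>m\<in>M. Q m x * P m x)"
    by (rule germ_sum[OF is_nash_mult[OF Q(1) P] M(1)])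
  finally have "germ (\<lambda>x. \<Sum>m\<in>M. Q m x * P m x) = \<zero>\<^bsub>K\<^esub>" using zero by simp
  then have ev0: "eventually (\<lambda>x. (\<Sum>m\<in>M. Q m x * P m x) = 0) F"
    by (rule germ_eq_zero_iff[THEN iffD1, OF is_nash_sum[OF is_nash_mult[OF Q(1) P]]])
  have "eventually (\<lambda>x. has_dpart (s j) (Q m) 0 x) F" if j: "j < n" for m j
  proof -
    have "nash_partial \<Omega> (s j) (q m) = \<zero>\<^bsub>K\<^esub>"
      using fun_cong[OF D[OF j, unfolded D_set_def mem_Collect_eq npoly_zero], of m] .
    then have "eventually (\<lambda>x. dpart (s j) (Q m) x = 0) F"
      using germ_eq_zero_iff[OF is_nash_dpart[OF Q(1)]] by (simp add: Q(2) partial_germ[OF Q(1)])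
    with eventually_has_dpart[OF Q(1), of "s j" m] show ?thesis by eventually_elim simp
  qed
  then have "eventually (\<lambda>x. \<forall>m\<in>M. \<forall>j\<in>{..<n}. has_dpart (s j) (Q m) 0 x) F"
    by (intro eventually_ball_finite M(1) ballI finite_lessThan) simp
  with ev0 have "eventually (\<lambda>x. (\<Sum>m\<in>M. Q m x * P m x) = 0 \<and>
      (\<forall>m\<in>M. \<forall>j\<in>{..<n}. has_dpart (s j) (Q m) 0 x)) F"
    by (rule eventually_conj)
  then obtain U where U: "U \<in> \<Omega>" "\<And>x. x \<in> U \<Longrightarrow> (\<Sum>m\<in>M. Q m x * P m x) = 0"
    "\<And>x m j. x \<in> U \<Longrightarrow> m \<in> M \<Longrightarrow> j < n \<Longrightarrow> has_dpart (s j) (Q m) 0 x"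
    unfolding eventually_nash by auto
  have "\<forall>m\<in>M. \<forall>x\<in>U. Q m x = 0"
  proof (rule monomials_independent[where s = s and V = "{..<n}" and e = count
        and d = "\<Sum>m\<in>M. \<Sum>j<n. count m j"])
    fix m m' assume *: "m \<in> M" "m' \<in> M" "\<And>j. j \<in> {..<n} \<Longrightarrow> count m j = count m' j"
    show "m = m'"
    proof (rule multiset_eqI)
      fix j show "count m j = count m' j"
      proof (cases "j < n")
        case False
        then have "j \<notin># m" "j \<notin># m'" using sub * by blast+
        then show ?thesis by (simp add: not_in_iff)
      qed (use * in simp)
    qed
  next
    fix x assume "x \<in> U"
    have "P m x = (\<Prod>j<n. x (s j) ^ count m j)" if "m \<in> M" for m
      unfolding P_def
      by (rule prod.mono_neutral_left) (use sub[OF that] in \<open>auto simp: not_in_iff\<close>)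
    with U(2)[OF \<open>x \<in> U\<close>] show "(\<Sum>m\<in>M. Q m x * (\<Prod>j<n. x (s j) ^ count m j)) = 0" by simp
  next
    fix m assume "m \<in> M"
    then show "(\<Sum>j<n. count m j) \<le> (\<Sum>m\<in>M. \<Sum>j<n. count m j)"
      using M(1) by (intro member_le_sum) auto
  qed (use \<Omega>_open[OF U(1)] inj M(1) U(3) in auto)
  then have van: "q m = \<zero>\<^bsub>K\<^esub>" if "m \<in> M" for m
  proof -
    have "eventually (\<lambda>x. Q m x = 0) F"
      unfolding eventually_nash using \<open>\<forall>m\<in>M. \<forall>x\<in>U. Q m x = 0\<close> that by (intro bexI[OF _ U(1)]) simp
    then show ?thesis unfolding Q(2) by (rule germ_eq_zero_iff[THEN iffD2, OF Q(1)])
  qed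
  from M(2) obtain m where "m \<in> M" by blast
  with van[OF this] show False by (simp add: M_def)
qed

end

section \<open>Solving a differential equation with the constructed derivation\<close>

theorem theorem7:
  fixes \<Omega> :: "('t::linorder \<Rightarrow> complex) set set"
    and Tf :: "'t nash_poly_pair \<Rightarrow> 't set"
    and \<tau> :: "'t nash_poly_pair \<Rightarrow> nat \<Rightarrow> 't"
    and r :: "'t nash_poly_pair \<Rightarrow> 't nash_germ"
    and f g :: "'t \<Rightarrow> 't nash_germ"
  assumes "infinite (UNIV :: 't set)"
    and "c_filter \<Omega>"
    and "nash_construction \<Omega> Tf \<tau> r f g"
  shows "differentially_closed_field (nash_field \<Omega>) (nash_delta \<Omega> g)"
proof -
  interpret nash \<Omega> by unfold_locales (rule assms(2))
  let ?\<delta> = "nash_delta \<Omega> g"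
  have constr: "(\<forall>i<nat (npoly_ord K p). \<tau> (p, q) i \<in> D_set \<Omega> p \<inter> D_set \<Omega> q \<inter> Tf (p, q)) \<and>
      (\<forall>i j. i < j \<and> j < nat (npoly_ord K p) \<longrightarrow> \<tau> (p, q) i < \<tau> (p, q) j) \<and>
      r (p, q) \<in> carrier K \<and>
      npoly_eval K p (\<lambda>j. if j < nat (npoly_ord K p) then nash_var \<Omega> (\<tau> (p, q) j) else r (p, q)) =
        \<zero>\<^bsub>K\<^esub> \<and>
      (\<forall>i. i + 1 < nat (npoly_ord K p) \<longrightarrow> g (\<tau> (p, q) i) = nash_var \<Omega> (\<tau> (p, q) (i + 1))) \<and>
      (nat (npoly_ord K p) > 0 \<longrightarrow> g (\<tau> (p, q) (nat (npoly_ord K p) - 1)) = r (p, q)) \<and>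
      (\<forall>t\<in>Tf (p, q) - \<tau> (p, q) ` {..<nat (npoly_ord K p)}. g t = f t)"
    (is "?R p q") if "(p, q) \<in> A_pairs \<Omega>" for p q
  proof -
    have "\<forall>(P, Q)\<in>A_pairs \<Omega>. ?R P Q"
      using assms(3) unfolding nash_construction_def Let_def by (elim conjE)
    from bspec[OF this that] show ?thesis unfolding prod.case .
  qed
  have cover: "(\<Union>S\<in>A_pairs \<Omega>. Tf S) = UNIV" and f: "f t \<in> carrier K" for t
    using assms(3) unfolding nash_construction_def by simp_all
  \<comment> \<open>The construction prescribes \<open>g\<close> on the blocks
    \<open>Tf (p, q)\<close>; as they cover the index set, every value is a variable, a root or a
    value of \<open>f\<close>.\<close>
  have g: "g t \<in> carrier K" for t
  proof -
    from cover have "t \<in> (\<Union>S\<in>A_pairs \<Omega>. Tf S)" by simp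
    then obtain p q where pq: "(p, q) \<in> A_pairs \<Omega>" "t \<in> Tf (p, q)" by auto
    define n where "n = nat (npoly_ord K p)"
    note c = constr[OF pq(1), folded n_def]
    show ?thesis
    proof (cases "t \<in> \<tau> (p, q) ` {..<n}")
      case True
      then obtain i where i: "t = \<tau> (p, q) i" "i < n" by auto
      show ?thesis
      proof (cases "i + 1 < n")
        case True
        with c i nash_var_carrier show ?thesis by simp
      next
        case False
        with i have "i = n - 1" "n > 0" by auto
        with c i show ?thesis by simp
      qed
    next
      case False
      with c pq(2) f show ?thesis by simp
    qed
  qed
  have "\<exists>a\<in>carrier K. diffpoly_eval K ?\<delta> p a = \<zero>\<^bsub>K\<^esub> \<and> diffpoly_eval K ?\<delta> q a \<noteq> \<zero>\<^bsub>K\<^esub>"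
    if p: "p \<in> npolys K" and q: "q \<in> npolys K"
      and less: "npoly_ord K q < npoly_ord K p" and nz: "q \<noteq> npoly_zero K" for p q
  proof -
    define n where "n = nat (npoly_ord K p)"
    have n: "npoly_ord K p = int n" using less npoly_ord_ge[of q] by (simp add: n_def)
    define s where "s = \<tau> (p, q)"
    note c = constr[OF A_pairsI[OF p q less nz], folded n_def s_def]
    \<comment> \<open>The intended successive derivatives of the solution \<open>y 0\<close>: the
      variables below index \<open>n\<close>, then the root at \<open>n\<close>. For
      \<open>n = 0\<close> the solution is the root itself; the values beyond \<open>n\<close> are
      fillers.\<close>
    define y where "y = (\<lambda>j. if j < n then nash_var \<Omega> (s j) else r (p, q))"
    have y: "y j \<in> carrier K" for j using c nash_var_carrier by (simp add: y_def)
    have step: "?\<delta> (y j) = y (Suc j)" if j: "j < n" for j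
    proof (cases "Suc j < n")
      case True
      with c j show ?thesis by (simp add: y_def delta_var[OF g])
    next
      case False
      with j have "j = n - 1" "n > 0" by auto
      with c j False show ?thesis by (simp add: y_def delta_var[OF g])
    qed
    \<comment> \<open>The root is the last derivative under control; its own derivative is unknown,
      but \<open>p\<close> has no variable beyond \<open>n\<close>.\<close>
    have iter: "(?\<delta> ^^ j) (y 0) = y j" if "j \<le> n" for j
      using that by (induction j) (simp_all add: step)
    have "diffpoly_eval K ?\<delta> p (y 0) = npoly_eval K p y"
      unfolding diffpoly_eval_def
    proof (rule npoly_eval_cong[OF p y])
      fix m j assume "p m \<noteq> \<zero>\<^bsub>K\<^esub>" "j \<in># m"
      from le_npoly_ord[OF p this] show "(?\<delta> ^^ j) (y 0) = y j" by (intro iter) (simp add: n)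
    qed
    also have "\<dots> = \<zero>\<^bsub>K\<^esub>" using c by (simp add: y_def)
    finally have "diffpoly_eval K ?\<delta> p (y 0) = \<zero>\<^bsub>K\<^esub>" .
    \<comment> \<open>The variables of \<open>q\<close> are below \<open>n\<close>, so the root does
      not enter and only independent variables are substituted.\<close>
    moreover have "diffpoly_eval K ?\<delta> q (y 0) = npoly_eval K q (\<lambda>j. nash_var \<Omega> (s j))"
      unfolding diffpoly_eval_def
    proof (rule npoly_eval_cong[OF q nash_var_carrier])
      fix m j assume "q m \<noteq> \<zero>\<^bsub>K\<^esub>" "j \<in># m"
      from le_npoly_ord[OF q this] less n have "j < n" by simp
      then show "(?\<delta> ^^ j) (y 0) = nash_var \<Omega> (s j)" by (simp add: iter) (simp add: y_def)
    qed
    moreover have "npoly_eval K q (\<lambda>j. nash_var \<Omega> (s j)) \<noteq> \<zero>\<^bsub>K\<^esub>"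
    proof (rule npoly_eval_vars_nonzero[OF q nz])
      show "npoly_ord K q < int n" using less n by simp
      \<comment> \<open>The order on the index set enters through the increasing choice of points,
        which makes them distinct.\<close>
      have "strict_mono_on {..<n} s" using c by (intro strict_mono_onI) simp
      then show "inj_on s {..<n}" by (rule strict_mono_on_imp_inj_on)
      show "s j \<in> D_set \<Omega> q" if "j < n" for j using c that by simp
    qed
    ultimately show ?thesis using y by (intro bexI[of _ "y 0"]) simp_all
  qed
  then show ?thesis
    unfolding differentially_closed_field_def using delta_differential_field[of g] g by blast
qed

end
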